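(* Let $H$ be a subgraph of a graph $G$ on $[n]$ such that $\mathcal E_G$ is a finitely generated left $\mathcal E_H$-module, and let $M\subset\mathcal E_G$ be a set of homogeneous right minimal coset representatives for $\mathcal E_H$ (i.e. a basis of $\mathcal E_G$ as a free left $\mathcal E_H$-module consisting of homogeneous elements). Then: (a) $M$ has a unique element $m_0$ of maximum degree; (b) for every $m\in M$ there exists $q^\vee\in\mathcal E_n^\vee$ with $q^\vee(\mathcal E_H^+\mathcal E_n)=0$ and $m\equiv q^\vee*m_0\pmod{\mathcal E_H^+\mathcal E_G}$; (c) for every $m\in M$ there exists $g\in\mathcal E_G$ with $m_0\equiv mg\pmod{\mathcal E_H^+\mathcal E_G}$.
   Context: Let $n\ge 1$. The Fomin–Kirillov algebra $\mathcal E_n$ is the associative $\mathbb Q$-algebra with generators $x_{ij}$ for ordered pairs of distinct $i,j\in[n]$, subject to $x_{ij}=-x_{ji}$, $x_{ij}^2=0$, $x_{ij}x_{kl}=x_{kl}x_{ij}$ for distinct $i,j,k,l$, and $x_{ij}x_{jk}+x_{jk}x_{ki}+x_{ki}x_{ij}=0$ for distinct $i,j,k$. It is graded by degree; $\mathcal E_n^d$ is the degree-$d$ part. For a simple graph $G$ on vertex set $[n]$, $\mathcal E_G$ is the subalgebra of $\mathcal E_n$ generated by the $x_{ij}$ with $\{i,j\}$ an edge of $G$, $\mathcal E_G^+$ its positive-degree part; $\mathcal E_H^+\mathcal E_G$ (resp. $\mathcal E_H^+\mathcal E_n$) is the span of products $ab$ with $a\in\mathcal E_H^+$ and $b\in\mathcal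 E_G$ (resp. $b\in\mathcal E_n$). It is known that $\mathcal E_G$ is a free left $\mathcal E_H$-module for $H\subseteq G$. $\mathcal E_n$ is also graded by $S_n$: the $S_n$-degree of $x_{ij}$ is the transposition $(i\,j)$, extended multiplicatively to monomials; $\sigma_P$ denotes the $S_n$-degree of an $S_n$-homogeneous $P$; $S_n$ acts by automorphisms via $\sigma(x_{ij})=x_{\sigma(i)\sigma(j)}$. Equip $\mathcal E_n\otimes\mathcal E_n$ with the braided product $(P_1\otimes Q_1)(P_2\otimes Q_2)=P_1\sigma_{Q_1}(P_2)\otimes Q_1Q_2$ for $S_n$-homogeneous $Q_1$. The coproduct $\Delta:\mathcal E_n\to\mathcal E_n\otimes\mathcal E_n$ is the (well-defined) map multiplicative for this product with $\Delta(x_{ij})=x_{ij}\otimes1+1\otimes x_{ij}$. Let $\mathcal E_n^\vee=\bigoplus_d(\mathcal E_n^d)^*$; for $p^\vee\in\mathcal E_n^\vee$ and $Q$ with $\Delta(Q)=\sum_k Q^k_{(1)}\otimes Q^k_{(2)}$, set $p^\vee*Q=\sum_k p^\vee(Q^k_{(1)})\,Q^k_{(2)}$. *)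

theory Defs
  imports Complex_Main
begin

text \<open>Fomin--Kirillov algebra E_n, realised as the free associative Q-algebra on
letters (i,j) (standing for x_ij), i,j in [n], i \<noteq> j, modulo the two-sided ideal
generated by the defining relations. Elements of the free algebra are finitely
supported functions from words to rat; elements of E_n are handled through
representatives modulo the ideal.\<close>

type_synonym letter = "nat \<times> nat"
type_synonym word = "letter list"
type_synonym fa = "word \<Rightarrow> rat"

definition supp :: "fa \<Rightarrow> word set" where
  "supp f = {w. f w \<noteq> 0}"

definition wrd :: "word \<Rightarrow> fa" where
  "wrd u = (\<lambda>w. if w = u then 1 else 0)"

definition fzero :: fa where
  "fzero = (\<lambda>w. 0)"

definition fadd :: "fa \<Rightarrow> fa \<Rightarrow> fa" where
  "fadd f g = (\<lambda>w. f w + g w)"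

definition fsub :: "fa \<Rightarrow> fa \<Rightarrow> fa" where
  "fsub f g = (\<lambda>w. f w - g w)"

definition fsmult :: "rat \<Rightarrow> fa \<Rightarrow> fa" where
  "fsmult c f = (\<lambda>w. c * f w)"

definition fmul :: "fa \<Rightarrow> fa \<Rightarrow> fa" where
  "fmul f g = (\<lambda>w. \<Sum>k\<le>length w. f (take k w) * g (drop k w))"

definition letters :: "nat \<Rightarrow> letter set" where
  "letters n = {(i, j). i \<in> {1..n} \<and> j \<in> {1..n} \<and> i \<noteq> j}"

definition FA :: "nat \<Rightarrow> fa set" where
  "FA n = {f. finite (supp f) \<and> (\<forall>w\<in>supp f. set w \<subseteq> letters n)}"

definition rels :: "nat \<Rightarrow> fa set" where
  "rels n =
     {fadd (wrd [(i,j)]) (wrd [(j,i)]) | i j. (i,j) \<in> letters n}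
   \<union> {wrd [(i,j),(i,j)] | i j. (i,j) \<in> letters n}
   \<union> {fsub (wrd [(i,j),(k,l)]) (wrd [(k,l),(i,j)]) | i j k l.
        distinct [i,j,k,l] \<and> (i,j) \<in> letters n \<and> (k,l) \<in> letters n}
   \<union> {fadd (fadd (wrd [(i,j),(j,k)]) (wrd [(j,k),(k,i)])) (wrd [(k,i),(i,j)]) | i j k.
        distinct [i,j,k] \<and> i \<in> {1..n} \<and> j \<in> {1..n} \<and> k \<in> {1..n}}"

inductive_set Ideal :: "nat \<Rightarrow> fa set" for n where
  gen: "r \<in> rels n \<Longrightarrow> r \<in> Ideal n"
| zero: "fzero \<in> Ideal n"
| add: "a \<in> Ideal n \<Longrightarrow> b \<in> Ideal n \<Longrightarrow> fadd a b \<in> Ideal n"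
| smult: "a \<in> Ideal n \<Longrightarrow> fsmult c a \<in> Ideal n"
| lmul: "a \<in> Ideal n \<Longrightarrow> set u \<subseteq> letters n \<Longrightarrow> fmul (wrd u) a \<in> Ideal n"
| rmul: "a \<in> Ideal n \<Longrightarrow> set u \<subseteq> letters n \<Longrightarrow> fmul a (wrd u) \<in> Ideal n"

definition eqv :: "nat \<Rightarrow> fa \<Rightarrow> fa \<Rightarrow> bool" where
  "eqv n f g \<longleftrightarrow> fsub f g \<in> Ideal n"

definition simple_graph :: "nat \<Rightarrow> nat set set \<Rightarrow> bool" where
  "simple_graph n G \<longleftrightarrow>
     (\<forall>e\<in>G. \<exists>i j. e = {i, j} \<and> i \<noteq> j \<and> i \<in> {1..n} \<and> j \<in> {1..n})"

definition gletters :: "nat set set \<Rightarrow> letter set" where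
  "gletters G = {(i, j). {i, j} \<in> G \<and> i \<noteq> j}"

definition EG :: "nat \<Rightarrow> nat set set \<Rightarrow> fa set" where
  "EG n G = {f \<in> FA n. \<exists>g \<in> FA n. eqv n f g \<and>
               (\<forall>w\<in>supp g. set w \<subseteq> gletters G)}"

definition EGplus :: "nat \<Rightarrow> nat set set \<Rightarrow> fa set" where
  "EGplus n G = {f \<in> FA n. \<exists>g \<in> FA n. eqv n f g \<and>
               (\<forall>w\<in>supp g. set w \<subseteq> gletters G \<and> w \<noteq> [])}"

inductive_set spn :: "fa set \<Rightarrow> fa set" for S where
  base: "a \<in> S \<Longrightarrow> a \<in> spn S"
| zero: "fzero \<in> spn S"
| add: "a \<in> spn S \<Longrightarrow> b \<in> spn S \<Longrightarrow> fadd a b \<in> spn S"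
| smult: "a \<in> spn S \<Longrightarrow> fsmult c a \<in> spn S"

definition prodspace :: "nat \<Rightarrow> fa set \<Rightarrow> fa set \<Rightarrow> fa set" where
  "prodspace n A B = {f \<in> FA n. \<exists>g \<in> spn {fmul a b | a b. a \<in> A \<and> b \<in> B}. eqv n f g}"

definition homog :: "nat \<Rightarrow> nat \<Rightarrow> fa \<Rightarrow> bool" where
  "homog n d f \<longleftrightarrow> f \<in> FA n \<and>
     (\<exists>g \<in> FA n. eqv n f g \<and> (\<forall>w\<in>supp g. length w = d))"

definition lcomb :: "fa set \<Rightarrow> (fa \<Rightarrow> fa) \<Rightarrow> fa" where
  "lcomb F c = (\<lambda>w. \<Sum>m\<in>F. fmul (c m) m w)"

definition generates :: "nat \<Rightarrow> nat set set \<Rightarrow> nat set set \<Rightarrow> fa set \<Rightarrow> bool" where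
  "generates n H G S \<longleftrightarrow>
     (\<forall>f\<in>EG n G. \<exists>F c. finite F \<and> F \<subseteq> S \<and> (\<forall>m\<in>F. c m \<in> EG n H) \<and>
        eqv n f (lcomb F c))"

definition lin_indep :: "nat \<Rightarrow> nat set set \<Rightarrow> fa set \<Rightarrow> bool" where
  "lin_indep n H S \<longleftrightarrow>
     (\<forall>F c. finite F \<and> F \<subseteq> S \<and> (\<forall>m\<in>F. c m \<in> EG n H) \<and> eqv n (lcomb F c) fzero
        \<longrightarrow> (\<forall>m\<in>F. eqv n (c m) fzero))"

definition fin_gen :: "nat \<Rightarrow> nat set set \<Rightarrow> nat set set \<Rightarrow> bool" where
  "fin_gen n H G \<longleftrightarrow> (\<exists>S. finite S \<and> S \<subseteq> EG n G \<and> generates n H G S)"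

definition hom_coset_reps :: "nat \<Rightarrow> nat set set \<Rightarrow> nat set set \<Rightarrow> fa set \<Rightarrow> bool" where
  "hom_coset_reps n H G M \<longleftrightarrow> M \<subseteq> EG n G \<and> (\<forall>m\<in>M. \<exists>d. homog n d m) \<and>
     generates n H G M \<and> lin_indep n H M"

text \<open>Graded dual: functionals given by their values on words, vanishing in
large degree, and vanishing on the ideal (so they are functionals on E_n).\<close>
definition pair :: "(word \<Rightarrow> rat) \<Rightarrow> fa \<Rightarrow> rat" where
  "pair \<psi> f = (\<Sum>w\<in>supp f. f w * \<psi> w)"

definition gdual :: "nat \<Rightarrow> (word \<Rightarrow> rat) \<Rightarrow> bool" where
  "gdual n \<psi> \<longleftrightarrow> (\<exists>D. \<forall>w. D < length w \<longrightarrow> \<psi> w = 0) \<and> (\<forall>r\<in>Ideal n. pair \<psi> r = 0)"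

text \<open>S_n-degree of a word: sigma_(t1...tr) = (t1) o ... o (tr), so that
sigma_(PQ) = sigma_P o sigma_Q; and the action sigma(x_ij) = x_(sigma i, sigma j).\<close>
definition transp :: "letter \<Rightarrow> nat \<Rightarrow> nat" where
  "transp t = (\<lambda>k. if k = fst t then snd t else if k = snd t then fst t else k)"

fun sigma_w :: "word \<Rightarrow> nat \<Rightarrow> nat" where
  "sigma_w [] = id"
| "sigma_w (t # ts) = transp t \<circ> sigma_w ts"

definition act :: "(nat \<Rightarrow> nat) \<Rightarrow> letter \<Rightarrow> letter" where
  "act \<sigma> t = (\<sigma> (fst t), \<sigma> (snd t))"

text \<open>Braided coproduct of a word: Delta(w) = sum over S (positions sent to the right
tensor factor) of  L_S \<otimes> R_S, where R_S is the subword at positions in S and the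
letter at a position i not in S is twisted by sigma of the right-factor letters before i.\<close>
definition cop_left :: "word \<Rightarrow> nat set \<Rightarrow> word" where
  "cop_left w S = [act (sigma_w (nths (take i w) S)) (w ! i). i \<leftarrow> [0..<length w], i \<notin> S]"

definition cop_right :: "word \<Rightarrow> nat set \<Rightarrow> word" where
  "cop_right w S = nths w S"

text \<open>p^\<vee> * Q = sum_k p^\<vee>(Q_(1)^k) Q_(2)^k, extended linearly.\<close>
definition costar :: "(word \<Rightarrow> rat) \<Rightarrow> fa \<Rightarrow> fa" where
  "costar \<psi> f = (\<lambda>v. \<Sum>w\<in>supp f. f w *
       (\<Sum>S\<in>Pow {0..<length w}. if cop_right w S = v then \<psi> (cop_left w S) else 0))"

end

theory Submission
  imports Defs "HOL-Library.Function_Algebras" "HOL-Library.Countable"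
begin

text \<open>
  Put \<open>A = \<E>\<^sub>G / \<E>\<^sub>H\<^sup>+ \<E>\<^sub>G\<close> and \<open>C = \<E>\<^sub>n / \<E>\<^sub>H\<^sup>+ \<E>\<^sub>n\<close>. The coproduct makes \<open>A\<close> a left \<open>C\<close>-comodule, so
  every functional \<open>q\<close> on \<open>C\<close> acts on \<open>A\<close> by \<open>a \<mapsto> q * a\<close>. A top-degree projection of the coproduct
  shows that \<open>\<E>\<^sub>n\<close> is free over \<open>\<E>\<^sub>G\<close>, whence \<open>A \<rightarrow> C\<close> is injective.

  Let \<open>d\<close> be the top degree of \<open>A\<close> and \<open>\<phi>\<close> a nonzero functional on \<open>A\<^sub>d\<close>, homogeneous for the
  \<open>S\<^sub>n\<close>-grading. Expanding \<open>q * (a g)\<close> by multiplicativity of the coproduct, the term \<open>(q * a) g\<close> equals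
  \<open>q * (a g)\<close> minus terms \<open>(q' * a) g'\<close> with \<open>g'\<close> of smaller degree. As \<open>a g = 0\<close> in degrees above
  \<open>d\<close>, induction on the degree of \<open>g\<close> shows that the radical of the form \<open>(a, g) \<mapsto> \<phi> (a g)\<close> is stable
  under all \<open>q\<close>; if it were nonzero, it would contain \<open>1\<close> because \<open>A\<close> embeds in \<open>C\<close>, which is
  absurd. Hence \<open>A\<^sub>d\<close> is a line and every nonzero \<open>a\<close> can be multiplied into it. The same
  induction applied to a generator \<open>w\<^sub>0\<close> of \<open>A\<^sub>d\<close> shows that \<open>{q * w\<^sub>0}\<close> is a right
  \<open>\<E>\<^sub>G\<close>-submodule containing \<open>1\<close>, hence all of \<open>A\<close>.

  Subspaces are handled through their annihilators: a functional is any function on words, and the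
  tensor square never appears explicitly.
\<close>

subsection \<open>Functionals on the free algebra\<close>

declare plus_fun_apply [simp del] zero_fun_apply [simp del] minus_apply [simp del]

lemmas fun_ops = plus_fun_apply zero_fun_apply minus_apply

interpretation fa: vector_space fsmult
  by unfold_locales (auto simp: fsmult_def fun_eq_iff fun_ops algebra_simps)

text \<open>A basis of \<open>U\<close> together with \<open>f\<close> is independent and extends to
  a basis of the whole space; the functional is the coordinate at \<open>f\<close> in that
  basis.\<close>

lemma separating_functional:
  assumes U: "fa.subspace U" and f: "f \<notin> U"
  obtains l where "\<And>x y. l (x + y) = l x + l y" "\<And>c x. l (fsmult c x) = c * l x"
    "\<And>x. x \<in> U \<Longrightarrow> l x = 0" "l f = 1"
proof -
  obtain B where B: "B \<subseteq> U" "fa.independent B" "fa.span B = U"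
    using fa.maximal_independent_subset[of U] fa.span_subspace[OF _ _ U] by metis
  have fB: "f \<notin> fa.span B" using B f by simp
  have ind: "fa.independent (insert f B)"
    using B fB by (simp add: fa.independent_insert)
  define E where "E = fa.extend_basis (insert f B)"
  have E: "fa.independent E" "fa.span E = UNIV" "insert f B \<subseteq> E"
    unfolding E_def using fa.independent_extend_basis[OF ind] fa.span_extend_basis[OF ind]
      fa.extend_basis_superset[OF ind] by blast+
  show ?thesis
  proof (rule that[of "\<lambda>x. fa.representation E x f"])
    show "fa.representation E (x + y) f = fa.representation E x f + fa.representation E y f" for x y
      using E by (simp add: fa.representation_add)
    show "fa.representation E (fsmult c x) f = c * fa.representation E x f" for c x
      using E by (simp add: fa.representation_scale)
    show "fa.representation E f f = 1"
      using E by (simp add: fa.representation_basis)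
    show "fa.representation E x f = 0" if "x \<in> U" for x
    proof -
      have "fa.representation E x = fa.representation B x"
        using fa.representation_extend[of E x B] E B that by auto
      then show ?thesis
        using fa.representation_ne_zero[of B x f] fB fa.span_base by metis
    qed
  qed
qed

lemma pair_superset:
  assumes "finite W" "supp f \<subseteq> W"
  shows "pair \<psi> f = (\<Sum>w\<in>W. f w * \<psi> w)"
  unfolding pair_def by (rule sum.mono_neutral_left) (use assms in \<open>auto simp: supp_def\<close>)

lemma supp_wrd [simp]: "supp (wrd u) = {u}"
  by (auto simp: supp_def wrd_def)

lemma supp_zero [simp]: "supp 0 = {}"
  by (auto simp: supp_def fun_ops)

lemma supp_plus: "supp (f + g) \<subseteq> supp f \<union> supp g"
  by (auto simp: supp_def fun_ops)

lemma supp_minus: "supp (f - g) \<subseteq> supp f \<union> supp g"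
  by (auto simp: supp_def fun_ops)

lemma supp_fsmult: "supp (fsmult c f) \<subseteq> supp f"
  by (auto simp: supp_def fsmult_def)

lemma finite_supp_plus: "finite (supp f) \<Longrightarrow> finite (supp g) \<Longrightarrow> finite (supp (f + g))"
  using finite_subset[OF supp_plus] by blast

lemma finite_supp_minus: "finite (supp f) \<Longrightarrow> finite (supp g) \<Longrightarrow> finite (supp (f - g))"
  using finite_subset[OF supp_minus] by blast

lemma finite_supp_fsmult: "finite (supp f) \<Longrightarrow> finite (supp (fsmult c f))"
  using finite_subset[OF supp_fsmult] by blast

lemma pair_wrd [simp]: "pair \<psi> (wrd u) = \<psi> u"
  by (simp add: pair_def) (simp add: wrd_def)

lemma pair_zero [simp]: "pair \<psi> 0 = 0"
  by (simp add: pair_def)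

lemma pair_plus:
  assumes "finite (supp f)" "finite (supp g)"
  shows "pair \<psi> (f + g) = pair \<psi> f + pair \<psi> g"
  using pair_superset[of "supp f \<union> supp g" f \<psi>] pair_superset[of "supp f \<union> supp g" g \<psi>]
    pair_superset[of "supp f \<union> supp g" "f + g" \<psi>] assms supp_plus[of f g]
  by (simp add: fun_ops distrib_right sum.distrib)

lemma pair_fsmult:
  assumes "finite (supp f)"
  shows "pair \<psi> (fsmult c f) = c * pair \<psi> f"
  using pair_superset[OF assms supp_fsmult, of \<psi> c] 
  by (simp add: pair_def fsmult_def sum_distrib_left mult.assoc)

lemma pair_minus:
  assumes "finite (supp f)" "finite (supp g)"
  shows "pair \<psi> (f - g) = pair \<psi> f - pair \<psi> g"
  using pair_superset[of "supp f \<union> supp g" f \<psi>] pair_superset[of "supp f \<union> supp g" g \<psi>]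
    pair_superset[of "supp f \<union> supp g" "f - g" \<psi>] assms supp_minus[of f g]
  by (simp add: fun_ops left_diff_distrib sum_subtractf)

lemma fa_sum_apply: "(\<Sum>i\<in>A. f i) w = (\<Sum>i\<in>A. f i w)" for f :: "'i \<Rightarrow> fa"
  by (induction A rule: infinite_finite_induct) (auto simp: fun_ops)

lemma finite_supp_sum:
  "(\<And>i. i \<in> A \<Longrightarrow> finite (supp (f i))) \<Longrightarrow> finite (supp (\<Sum>i\<in>A. f i))"
  by (induction A rule: infinite_finite_induct) (auto intro: finite_supp_plus)

lemma pair_sum:
  "(\<And>i. i \<in> A \<Longrightarrow> finite (supp (f i))) \<Longrightarrow> pair \<psi> (\<Sum>i\<in>A. f i) = (\<Sum>i\<in>A. pair \<psi> (f i))"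
  by (induction A rule: infinite_finite_induct) (auto simp: pair_plus finite_supp_sum)

lemma fa_expand:
  assumes "finite (supp f)"
  shows "f = (\<Sum>w\<in>supp f. fsmult (f w) (wrd w))"
proof
  fix v
  have "(\<Sum>w\<in>supp f. fsmult (f w) (wrd w)) v = (\<Sum>w\<in>supp f. if v = w then f w else 0)"
    unfolding fa_sum_apply by (rule sum.cong) (auto simp: fsmult_def wrd_def)
  also have "\<dots> = f v" using assms by (auto simp: supp_def fun_ops)
  finally show "f v = (\<Sum>w\<in>supp f. fsmult (f w) (wrd w)) v" by simp
qed

text \<open>On finitely supported elements every linear functional is \<open>pair\<close> with its
  values on words, so a functional separating \<open>f\<close> from \<open>U\<close> would
  contradict \<open>ann\<close>.\<close>

lemma double_annihilator:
  assumes U: "fa.subspace U" and f: "finite (supp f)"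
    and fin: "\<And>u. u \<in> U \<Longrightarrow> finite (supp u)"
    and ann: "\<And>\<psi>. (\<And>u. u \<in> U \<Longrightarrow> pair \<psi> u = 0) \<Longrightarrow> pair \<psi> f = 0"
  shows "f \<in> U"
proof (rule ccontr)
  assume "f \<notin> U"
  then obtain l where l: "\<And>x y. l (x + y) = l x + l y" "\<And>c x. l (fsmult c x) = c * l x"
    "\<And>x. x \<in> U \<Longrightarrow> l x = 0" "l f = (1::rat)"
    using separating_functional[OF U] by metis
  have l0: "l 0 = 0" using l(1)[of 0 0] by simp
  have lsum: "l (\<Sum>i\<in>A. h i) = (\<Sum>i\<in>A. l (h i))" for A :: "word set" and h
    by (induction A rule: infinite_finite_induct) (simp_all only: sum.infinite sum.empty sum.insert l(1) l0 not_False_eq_True)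
  have lp: "l g = pair (\<lambda>w. l (wrd w)) g" if "finite (supp g)" for g
  proof -
    have "l g = l (\<Sum>w\<in>supp g. fsmult (g w) (wrd w))" using fa_expand[OF that] by simp
    then show ?thesis by (simp add: lsum l(2) pair_def)
  qed
  have "pair (\<lambda>w. l (wrd w)) f = 0"
    by (rule ann) (use lp fin l(3) in metis)
  then show False using lp[OF f] l(4) by simp
qed

subsection \<open>The braided coproduct on words\<close>

lemma act_id [simp]: "act id = id"
  by (auto simp: act_def fun_eq_iff)

lemma act_act [simp]: "act \<sigma> (act \<tau> t) = act (\<sigma> \<circ> \<tau>) t"
  by (simp add: act_def)

lemma transp_transp [simp]: "transp t \<circ> transp t = id"
  by (auto simp: transp_def fun_eq_iff)

lemma transp_swap: "transp (j, i) = transp (i, j)"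
  by (auto simp: transp_def fun_eq_iff)

lemma sigma_w_append: "sigma_w (u @ v) = sigma_w u \<circ> sigma_w v"
  by (induction u) (simp_all add: comp_assoc)

lemma sigma_w_rev: "sigma_w (rev w) \<circ> sigma_w w = id"
proof (induction w)
  case (Cons t w)
  have "transp t (transp t k) = k" for k
    by (metis transp_transp comp_apply id_apply)
  then show ?case using Cons by (simp add: sigma_w_append fun_eq_iff)
qed simp

lemma inv_sigma_w: "inv (sigma_w w) = sigma_w (rev w)"
  using sigma_w_rev[of w] sigma_w_rev[of "rev w"] by (intro inv_unique_comp) simp_all

lemma surj_sigma_w: "surj (sigma_w w)"
  using sigma_w_rev[of "rev w"] by (metis comp_apply id_apply rev_rev_ident surjI)

text \<open>Injectivity is asked on all naturals, so that distinct indices stay distinct without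
  range conditions; on the finite set [n] such a map is a permutation.\<close>

definition index_perm :: "nat \<Rightarrow> (nat \<Rightarrow> nat) \<Rightarrow> bool" where
  "index_perm n \<sigma> \<longleftrightarrow> inj \<sigma> \<and> \<sigma> ` {1..n} \<subseteq> {1..n}"

lemma index_perm_comp: "index_perm n \<sigma> \<Longrightarrow> index_perm n \<tau> \<Longrightarrow> index_perm n (\<sigma> \<circ> \<tau>)"
  unfolding index_perm_def by (auto intro: inj_compose)

lemma index_perm_transp: "t \<in> letters n \<Longrightarrow> index_perm n (transp t)"
  unfolding index_perm_def
  by (auto simp: transp_def letters_def inj_on_def)

lemma index_perm_sigma_w: "set w \<subseteq> letters n \<Longrightarrow> index_perm n (sigma_w w)"
proof (induction w)
  case Nil then show ?case by (simp add: index_perm_def)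
next
  case (Cons t w) then show ?case 
    using index_perm_comp[OF index_perm_transp, of t n "sigma_w w"] by (simp del: comp_apply)
qed

lemma act_letters: "index_perm n \<sigma> \<Longrightarrow> t \<in> letters n \<Longrightarrow> act \<sigma> t \<in> letters n"
  by (cases t) (simp add: index_perm_def letters_def act_def inj_eq image_subset_iff)

lemma map_act_letters: "index_perm n \<sigma> \<Longrightarrow> set w \<subseteq> letters n \<Longrightarrow> set (map (act \<sigma>) w) \<subseteq> letters n"
  by (auto dest: act_letters)

section \<open>Recursive form of the coproduct\<close>

text \<open>The recursion is \<Delta>(t w) = (t \<otimes> 1 + 1 \<otimes> t) \<Delta>(w) for the
  braided product: a letter sent to the right twists the whole left factor of the remaining word. A
  list is used to keep multiplicities.\<close>

fun cops :: "word \<Rightarrow> (word \<times> word) list" where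
  "cops [] = [([], [])]"
| "cops (t # w) = map (\<lambda>(L, R). (t # L, R)) (cops w)
     @ map (\<lambda>(L, R). (map (act (transp t)) L, t # R)) (cops w)"

text \<open>The bilinear functional \<open>h\<close> evaluated at \<Delta>(\<open>w\<close>), so
  that tensors enter only through their values.\<close>

definition copsum :: "(word \<Rightarrow> word \<Rightarrow> rat) \<Rightarrow> word \<Rightarrow> rat" where
  "copsum h w = (\<Sum>p\<leftarrow>cops w. h (fst p) (snd p))"

lemma copsum_Nil [simp]: "copsum h [] = h [] []"
  by (simp add: copsum_def)

lemma copsum_Cons [simp]:
  "copsum h (t # w) = copsum (\<lambda>L R. h (t # L) R) w
     + copsum (\<lambda>L R. h (map (act (transp t)) L) (t # R)) w"
  by (simp add: copsum_def case_prod_beta comp_def)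

lemma copsum_cong:
  "(\<And>L R. (L, R) \<in> set (cops w) \<Longrightarrow> h L R = h' L R) \<Longrightarrow> copsum h w = copsum h' w"
  unfolding copsum_def by (intro arg_cong[where f = sum_list] map_cong) auto

lemma copsum_zero:
  "(\<And>L R. (L, R) \<in> set (cops w) \<Longrightarrow> h L R = 0) \<Longrightarrow> copsum h w = 0"
  using copsum_cong[of w h "\<lambda>_ _. 0"] by (simp add: copsum_def)

lemma copsum_add: "copsum (\<lambda>L R. h L R + h' L R) w = copsum h w + copsum h' w"
  by (simp add: copsum_def sum_list_addf)

lemma copsum_minus: "copsum (\<lambda>L R. - h L R) w = - copsum h w"
  by (simp add: copsum_def uminus_sum_list_map comp_def)

lemma copsum_diff: "copsum (\<lambda>L R. h L R - h' L R) w = copsum h w - copsum h' w"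
  using copsum_add[of h "\<lambda>L R. - h' L R" w] by (simp add: copsum_minus)

lemma copsum_mult_left: "copsum (\<lambda>L R. c * h L R) w = c * copsum h w"
  by (simp add: copsum_def sum_list_const_mult)

lemma copsum_mult_right: "copsum (\<lambda>L R. h L R * c) w = copsum h w * c"
  by (simp add: copsum_def sum_list_mult_const)

lemma copsum_sum: "copsum (\<lambda>L R. \<Sum>i\<in>A. h i L R) w = (\<Sum>i\<in>A. copsum (h i) w)"
proof (induction A rule: infinite_finite_induct)
  case (insert x F) then show ?case by (simp add: copsum_add)
qed (simp_all add: copsum_def)

lemma copsum_swap:
  "copsum (\<lambda>L R. copsum (h L R) v) u = copsum (\<lambda>L' R'. copsum (\<lambda>L R. h L R L' R') u) v"
proof -
  have "(\<Sum>p\<leftarrow>xs. \<Sum>q\<leftarrow>ys. f p q) = (\<Sum>q\<leftarrow>ys. \<Sum>p\<leftarrow>xs. f p q)"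
    for f :: "word \<times> word \<Rightarrow> word \<times> word \<Rightarrow> rat" and xs ys
    by (induction xs) (simp_all add: sum_list_addf)
  then show ?thesis unfolding copsum_def .
qed

text \<open>Multiplicativity of the coproduct for (L \<otimes> R)(L' \<otimes> R') = L
  \<sigma>_R(L') \<otimes> R R'; the twists by the single letters of R compose to
  \<sigma>_R.\<close>

lemma copsum_append:
  "copsum h (u @ v) =
     copsum (\<lambda>L R. copsum (\<lambda>L' R'. h (L @ map (act (sigma_w R)) L') (R @ R')) v) u"
proof (induction u arbitrary: h)
  case Nil then show ?case by simp
next
  case (Cons t u) then show ?case by (simp add: comp_def)
qed

text \<open>The left factor is empty only if every letter is sent to the right, so 1 \<otimes>
  \<open>w\<close> is the single such term.\<close>

lemma copsum_split_left_Nil: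
  "copsum h w = h [] w + copsum (\<lambda>L R. if L = [] then 0 else h L R) w"
proof (induction w arbitrary: h)
  case (Cons t w)
  show ?case
    using Cons[of "\<lambda>L R. h (map (act (transp t)) L) (t # R)"] by simp
qed simp

lemma copsum_split_right_Nil:
  "copsum h w = h w [] + copsum (\<lambda>L R. if R = [] then 0 else h L R) w"
proof (induction w arbitrary: h)
  case (Cons t w)
  show ?case
    using Cons[of "\<lambda>L R. h (t # L) R"] by simp
qed simp

lemma cops_length: "(L, R) \<in> set (cops w) \<Longrightarrow> length L + length R = length w"
  by (induction w arbitrary: L R) auto

lemma cops_Nil_left: "([], R) \<in> set (cops w) \<Longrightarrow> R = w"
  by (induction w arbitrary: R) auto

lemma cops_Cons_cases:
  assumes "(L, R) \<in> set (cops (t # w))"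
  obtains L' where "L = t # L'" "(L', R) \<in> set (cops w)"
    | L' R' where "L = map (act (transp t)) L'" "R = t # R'" "(L', R') \<in> set (cops w)"
  using assms by auto

lemma cops_right: "(L, R) \<in> set (cops w) \<Longrightarrow> set R \<subseteq> set w"
proof (induction w arbitrary: L R)
  case (Cons t w)
  from Cons.prems show ?case by (cases rule: cops_Cons_cases) (auto dest: Cons.IH)
qed simp

lemma cops_left: "(L, R) \<in> set (cops w) \<Longrightarrow> set w \<subseteq> letters n \<Longrightarrow> set L \<subseteq> letters n"
proof (induction w arbitrary: L R)
  case (Cons t w)
  have t: "t \<in> letters n" and w: "set w \<subseteq> letters n" using Cons.prems(2) by auto
  from Cons.prems(1) show ?case
  proof (cases rule: cops_Cons_cases)
    case (1 L')
    then show ?thesis using Cons.IH[OF 1(2) w] t by simp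
  next
    case (2 L' R')
    show ?thesis
      unfolding 2(1) using Cons.IH[OF 2(3) w] t by (intro map_act_letters index_perm_transp)
  qed
qed simp

text \<open>Conjugating a transposition relabels its two entries, and this relabelling is
  \<open>act\<close>.\<close>

lemma transp_map_act: "transp (act (transp s) t) \<circ> transp s = transp s \<circ> transp t"
  by (auto simp: transp_def act_def fun_eq_iff)

lemma sigma_w_map_act: "sigma_w (map (act (transp s)) w) \<circ> transp s = transp s \<circ> sigma_w w"
proof (induction w)
  case (Cons t w)
  have "sigma_w (map (act (transp s)) (t # w)) \<circ> transp s
      = transp (act (transp s) t) \<circ> (sigma_w (map (act (transp s)) w) \<circ> transp s)"
    by (simp add: comp_assoc)
  also have "\<dots> = (transp (act (transp s) t) \<circ> transp s) \<circ> sigma_w w"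
    by (simp only: Cons comp_assoc)
  finally show ?case by (simp only: transp_map_act comp_assoc sigma_w.simps)
qed simp

text \<open>The coproduct preserves the S_n-degree: a letter sent to the right conjugates the degree
  of the left factor, which compensates for its moving past that factor.\<close>

lemma cops_sigma_w: "(L, R) \<in> set (cops w) \<Longrightarrow> sigma_w L \<circ> sigma_w R = sigma_w w"
proof (induction w arbitrary: L R)
  case (Cons t w)
  from Cons.prems show ?case
  proof (cases rule: cops_Cons_cases)
    case (1 L')
    then show ?thesis using Cons.IH[OF 1(2)] by (simp only: comp_assoc sigma_w.simps)
  next
    case (2 L' R')
    have "sigma_w L \<circ> sigma_w R = (sigma_w (map (act (transp t)) L') \<circ> transp t) \<circ> sigma_w R'"
      using 2 by (simp only: comp_assoc sigma_w.simps)
    also have "\<dots> = transp t \<circ> (sigma_w L' \<circ> sigma_w R')"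
      by (simp only: sigma_w_map_act comp_assoc)
    finally show ?thesis using Cons.IH[OF 2(3)] by (simp only: sigma_w.simps)
  qed
qed simp

text \<open>The degree of the right factor is determined by the left factor and the total degree,
  which is what allows \<open>braid\<close> to be written without the right factor.\<close>

lemma cops_sigma_right:
  assumes "(L, R) \<in> set (cops w)"
  shows "sigma_w R = inv (sigma_w L) \<circ> sigma_w w"
proof -
  have "inv (sigma_w L) \<circ> sigma_w w = (sigma_w (rev L) \<circ> sigma_w L) \<circ> sigma_w R"
    by (simp only: inv_sigma_w cops_sigma_w[OF assms, symmetric] comp_assoc)
  then show ?thesis by (simp add: sigma_w_rev)
qed

section \<open>Agreement with the coproduct given by position sets\<close>

lemma Pow_atLeast0_lessThan_Suc:
  "Pow {0..<Suc k} = (\<lambda>S. Suc ` S) ` Pow {0..<k} \<union> (\<lambda>S. insert 0 (Suc ` S)) ` Pow {0..<k}"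
proof -
  have "{0..<Suc k} = insert 0 (Suc ` {0..<k})"
    by (simp add: image_Suc_atLeastLessThan) auto
  moreover have "Pow (Suc ` {0..<k}) = (\<lambda>S. Suc ` S) ` Pow {0..<k}"
    by (rule image_Pow_surj[OF refl, symmetric])
  ultimately show ?thesis
    by (simp only: Pow_insert image_image)
qed

lemma cop_left_Cons:
  "cop_left (t # w) S = (if 0 \<in> S then map (act (transp t)) (cop_left w {j. Suc j \<in> S})
     else t # cop_left w {j. Suc j \<in> S})"
proof -
  have "[0..<Suc (length w)] = 0 # map Suc [0..<length w]"
    by (simp only: upt_conv_Cons zero_less_Suc map_Suc_upt)
  then show ?thesis
    by (simp add: cop_left_def nths_Cons map_concat comp_def if_distrib cong: if_cong)
qed

text \<open>Whether position 0 belongs to \<open>S\<close> is the choice made for the first letter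
  in \<open>cops\<close>; the other positions, shifted by one, form a position set of the
  tail.\<close>

lemma sum_Pow_cop:
  "(\<Sum>S\<in>Pow {0..<length w}. h (cop_left w S) (cop_right w S)) = copsum h w"
proof (induction w arbitrary: h)
  case Nil then show ?case by (simp add: cop_left_def cop_right_def)
next
  case (Cons t w)
  have inj1: "inj_on (\<lambda>S. Suc ` S) A" for A
    by (auto simp: inj_on_def inj_image_eq_iff)
  have inj2: "inj_on (\<lambda>S. insert 0 (Suc ` S)) A" for A
  proof (rule inj_onI)
    fix S T assume "insert 0 (Suc ` S) = insert 0 (Suc ` T)"
    then have "Suc ` S = Suc ` T" by (metis Diff_insert_absorb image_iff nat.distinct(1))
    then show "S = T" by (simp add: inj_image_eq_iff)
  qed
  have dj: "(\<lambda>S. Suc ` S) ` Pow {0..<length w} \<inter> (\<lambda>S. insert 0 (Suc ` S)) ` Pow {0..<length w} = {}"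
    by auto
  have "{j. Suc j \<in> Suc ` S} = S" for S by auto
  then show ?case
    unfolding length_Cons Pow_atLeast0_lessThan_Suc
    by (subst sum.union_disjoint[OF _ _ dj])
       (simp_all add: sum.reindex inj1 inj2 cop_left_Cons cop_right_def nths_Cons Cons[symmetric])
qed

subsection \<open>Functionals on the algebra\<close>

text \<open>These are the functionals on E_n: testing the relations between arbitrary words
  \<open>u\<close> and \<open>v\<close> amounts to vanishing on the two-sided ideal.\<close>

definition ann_rels :: "nat \<Rightarrow> (word \<Rightarrow> rat) \<Rightarrow> bool" where
  "ann_rels n \<psi> \<longleftrightarrow> (\<forall>u v. set u \<subseteq> letters n \<longrightarrow> set v \<subseteq> letters n \<longrightarrow>
     (\<forall>i j. (i, j) \<in> letters n \<longrightarrow>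
        \<psi> (u @ [(i, j)] @ v) + \<psi> (u @ [(j, i)] @ v) = 0 \<and> \<psi> (u @ [(i, j), (i, j)] @ v) = 0) \<and>
     (\<forall>i j k l. distinct [i, j, k, l] \<and> (i, j) \<in> letters n \<and> (k, l) \<in> letters n \<longrightarrow>
        \<psi> (u @ [(i, j), (k, l)] @ v) - \<psi> (u @ [(k, l), (i, j)] @ v) = 0) \<and>
     (\<forall>i j k. distinct [i, j, k] \<and> i \<in> {1..n} \<and> j \<in> {1..n} \<and> k \<in> {1..n} \<longrightarrow>
        \<psi> (u @ [(i, j), (j, k)] @ v) + \<psi> (u @ [(j, k), (k, i)] @ v)
          + \<psi> (u @ [(k, i), (i, j)] @ v) = 0))"

lemma
  assumes "ann_rels n \<psi>" "set u \<subseteq> letters n" "set v \<subseteq> letters n"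
  shows ann_rels_anti: "(i, j) \<in> letters n \<Longrightarrow> \<psi> (u @ (j, i) # v) = - \<psi> (u @ (i, j) # v)"
    and ann_rels_square: "(i, j) \<in> letters n \<Longrightarrow> \<psi> (u @ (i, j) # (i, j) # v) = 0"
    and ann_rels_comm: "distinct [i, j, k, l] \<Longrightarrow> (i, j) \<in> letters n \<Longrightarrow> (k, l) \<in> letters n \<Longrightarrow>
      \<psi> (u @ (i, j) # (k, l) # v) = \<psi> (u @ (k, l) # (i, j) # v)"
    and ann_rels_cyclic: "distinct [i, j, k] \<Longrightarrow> i \<in> {1..n} \<Longrightarrow> j \<in> {1..n} \<Longrightarrow> k \<in> {1..n} \<Longrightarrow>
      \<psi> (u @ (i, j) # (j, k) # v) + \<psi> (u @ (j, k) # (k, i) # v) + \<psi> (u @ (k, i) # (i, j) # v) = 0"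
proof -
  note * = assms(1)[unfolded ann_rels_def, rule_format, OF assms(2,3)]
  show "(i, j) \<in> letters n \<Longrightarrow> \<psi> (u @ (j, i) # v) = - \<psi> (u @ (i, j) # v)"
    using *[THEN conjunct1, rule_format, of i j] by (simp add: add_eq_0_iff)
  show "(i, j) \<in> letters n \<Longrightarrow> \<psi> (u @ (i, j) # (i, j) # v) = 0"
    using *[THEN conjunct1, rule_format, of i j] by simp
  show "distinct [i, j, k, l] \<Longrightarrow> (i, j) \<in> letters n \<Longrightarrow> (k, l) \<in> letters n \<Longrightarrow>
      \<psi> (u @ (i, j) # (k, l) # v) = \<psi> (u @ (k, l) # (i, j) # v)"
    using *[THEN conjunct2, THEN conjunct1, rule_format, of i j k l] by simp
  show "distinct [i, j, k] \<Longrightarrow> i \<in> {1..n} \<Longrightarrow> j \<in> {1..n} \<Longrightarrow> k \<in> {1..n} \<Longrightarrow>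
      \<psi> (u @ (i, j) # (j, k) # v) + \<psi> (u @ (j, k) # (k, i) # v) + \<psi> (u @ (k, i) # (i, j) # v) = 0"
    using *[THEN conjunct2, THEN conjunct2, rule_format, of i j k] by simp
qed

lemma ann_relsI:
  assumes "\<And>u v i j. set u \<subseteq> letters n \<Longrightarrow> set v \<subseteq> letters n \<Longrightarrow> (i, j) \<in> letters n \<Longrightarrow>
      \<psi> (u @ [(i, j)] @ v) + \<psi> (u @ [(j, i)] @ v) = 0"
    and "\<And>u v i j. set u \<subseteq> letters n \<Longrightarrow> set v \<subseteq> letters n \<Longrightarrow> (i, j) \<in> letters n \<Longrightarrow>
      \<psi> (u @ [(i, j), (i, j)] @ v) = 0"
    and "\<And>u v i j k l. set u \<subseteq> letters n \<Longrightarrow> set v \<subseteq> letters n \<Longrightarrow> distinct [i, j, k, l] \<Longrightarrow>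
      (i, j) \<in> letters n \<Longrightarrow> (k, l) \<in> letters n \<Longrightarrow>
      \<psi> (u @ [(i, j), (k, l)] @ v) - \<psi> (u @ [(k, l), (i, j)] @ v) = 0"
    and "\<And>u v i j k. set u \<subseteq> letters n \<Longrightarrow> set v \<subseteq> letters n \<Longrightarrow> distinct [i, j, k] \<Longrightarrow>
      i \<in> {1..n} \<Longrightarrow> j \<in> {1..n} \<Longrightarrow> k \<in> {1..n} \<Longrightarrow>
      \<psi> (u @ [(i, j), (j, k)] @ v) + \<psi> (u @ [(j, k), (k, i)] @ v) + \<psi> (u @ [(k, i), (i, j)] @ v) = 0"
  shows "ann_rels n \<psi>"
  unfolding ann_rels_def using assms by presburger

text \<open>The length and the \<open>S\<^sub>n\<close>-degree are constant on each relation, so the ideal is homogeneous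
  for both gradings.\<close>

lemma sigma_w_rels:
  shows "sigma_w (u @ [(j, i)] @ v) = sigma_w (u @ [(i, j)] @ v)"
    and "distinct [i, j, k, l] \<Longrightarrow> sigma_w (u @ [(k, l), (i, j)] @ v) = sigma_w (u @ [(i, j), (k, l)] @ v)"
    and "distinct [i, j, k] \<Longrightarrow> sigma_w (u @ [(j, k), (k, i)] @ v) = sigma_w (u @ [(i, j), (j, k)] @ v)"
    and "distinct [i, j, k] \<Longrightarrow> sigma_w (u @ [(k, i), (i, j)] @ v) = sigma_w (u @ [(i, j), (j, k)] @ v)"
  by (auto simp: sigma_w_append fun_eq_iff transp_def intro!: arg_cong[where f = "sigma_w u"])

lemma letters_iff: "(i, j) \<in> letters n \<longleftrightarrow> i \<in> {1..n} \<and> j \<in> {1..n} \<and> i \<noteq> j"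
  by (auto simp: letters_def)

text \<open>All words of one relation have the same length and S_n-degree, so the scalar and the
  appended word are constant along it. Special cases are homogeneous projections, right translates
  and \<open>braid\<close>.\<close>

lemma ann_rels_twist:
  assumes \<psi>: "ann_rels n \<psi>"
    and E: "\<And>u. set u \<subseteq> letters n \<Longrightarrow> set (E (length u) (sigma_w u)) \<subseteq> letters n"
  shows "ann_rels n (\<lambda>w. c (length w) (sigma_w w) * \<psi> (w @ E (length w) (sigma_w w)))"
proof (rule ann_relsI)
  fix u v i j assume uv: "set u \<subseteq> letters n" "set v \<subseteq> letters n" and ij: "(i, j) \<in> letters n"
  have e: "set (E (length (u @ [(i, j)] @ v)) (sigma_w (u @ [(i, j)] @ v))) \<subseteq> letters n"
    "set (E (length (u @ [(i, j),(i,j)] @ v)) (sigma_w (u @ [(i, j),(i,j)] @ v))) \<subseteq> letters n"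
    using uv ij by (intro E; simp)+
  show "c (length (u @ [(i, j)] @ v)) (sigma_w (u @ [(i, j)] @ v)) *
       \<psi> ((u @ [(i, j)] @ v) @ E (length (u @ [(i, j)] @ v)) (sigma_w (u @ [(i, j)] @ v))) +
       c (length (u @ [(j, i)] @ v)) (sigma_w (u @ [(j, i)] @ v)) *
       \<psi> ((u @ [(j, i)] @ v) @ E (length (u @ [(j, i)] @ v)) (sigma_w (u @ [(j, i)] @ v))) = 0"
    using ann_rels_anti[OF \<psi> uv(1) _ ij, of "v @ E (length (u @ [(i, j)] @ v)) (sigma_w (u @ [(i, j)] @ v))"] uv e
    unfolding sigma_w_rels(1)[of u j i v] by simp
  show "c (length (u @ [(i, j), (i, j)] @ v)) (sigma_w (u @ [(i, j), (i, j)] @ v)) *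
       \<psi> ((u @ [(i, j), (i, j)] @ v) @ E (length (u @ [(i, j), (i, j)] @ v)) (sigma_w (u @ [(i, j), (i, j)] @ v))) = 0"
    using ann_rels_square[OF \<psi> uv(1) _ ij, of "v @ E (length (u @ [(i, j), (i, j)] @ v)) (sigma_w (u @ [(i, j), (i, j)] @ v))"] uv e
    by simp
next
  fix u v i j k l assume uv: "set u \<subseteq> letters n" "set v \<subseteq> letters n"
    and ij: "distinct [i, j, k, l]" "(i, j) \<in> letters n" "(k, l) \<in> letters n"
  have e: "set (E (length (u @ [(i, j),(k,l)] @ v)) (sigma_w (u @ [(i, j),(k,l)] @ v))) \<subseteq> letters n"
    using uv ij by (intro E; simp)+
  show "c (length (u @ [(i, j), (k, l)] @ v)) (sigma_w (u @ [(i, j), (k, l)] @ v)) *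
       \<psi> ((u @ [(i, j), (k, l)] @ v) @ E (length (u @ [(i, j), (k, l)] @ v)) (sigma_w (u @ [(i, j), (k, l)] @ v))) -
       c (length (u @ [(k, l), (i, j)] @ v)) (sigma_w (u @ [(k, l), (i, j)] @ v)) *
       \<psi> ((u @ [(k, l), (i, j)] @ v) @ E (length (u @ [(k, l), (i, j)] @ v)) (sigma_w (u @ [(k, l), (i, j)] @ v))) = 0"
    using ann_rels_comm[OF \<psi> uv(1) _ ij, of "v @ E (length (u @ [(i, j), (k, l)] @ v)) (sigma_w (u @ [(i, j), (k, l)] @ v))"] uv e
    unfolding sigma_w_rels(2)[OF ij(1), of u v] by simp
next
  fix u v i j k assume uv: "set u \<subseteq> letters n" "set v \<subseteq> letters n"
    and ij: "distinct [i, j, k]" "i \<in> {1..n}" "j \<in> {1..n}" "k \<in> {1..n}"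
  define e where "e = E (length (u @ [(i, j),(j,k)] @ v)) (sigma_w (u @ [(i, j),(j,k)] @ v))"
  have e: "set e \<subseteq> letters n"
    unfolding e_def using uv ij by (intro E; simp add: letters_iff)+
  show "c (length (u @ [(i, j), (j, k)] @ v)) (sigma_w (u @ [(i, j), (j, k)] @ v)) *
       \<psi> ((u @ [(i, j), (j, k)] @ v) @ E (length (u @ [(i, j), (j, k)] @ v)) (sigma_w (u @ [(i, j), (j, k)] @ v))) +
       c (length (u @ [(j, k), (k, i)] @ v)) (sigma_w (u @ [(j, k), (k, i)] @ v)) *
       \<psi> ((u @ [(j, k), (k, i)] @ v) @ E (length (u @ [(j, k), (k, i)] @ v)) (sigma_w (u @ [(j, k), (k, i)] @ v))) +
       c (length (u @ [(k, i), (i, j)] @ v)) (sigma_w (u @ [(k, i), (i, j)] @ v)) *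
       \<psi> ((u @ [(k, i), (i, j)] @ v) @ E (length (u @ [(k, i), (i, j)] @ v)) (sigma_w (u @ [(k, i), (i, j)] @ v))) = 0"
    using ann_rels_cyclic[OF \<psi> uv(1) _ ij, of "v @ e"] uv e
    unfolding sigma_w_rels(3,4)[OF ij(1), of u v] 
    by (simp add: e_def flip: distrib_left del: sigma_w.simps)
qed

lemma ann_rels_restrict:
  assumes "ann_rels n \<psi>"
  shows "ann_rels n (\<lambda>w. if P (length w) (sigma_w w) then \<psi> w else 0)"
  using ann_rels_twist[OF assms, of "\<lambda>_ _. []" "\<lambda>k \<sigma>. if P k \<sigma> then 1 else 0"]
  by (simp add: if_distrib if_distribR cong: if_cong)

lemma ann_rels_shift:
  assumes \<psi>: "ann_rels n \<psi>" and x: "set x \<subseteq> letters n" and y: "set y \<subseteq> letters n"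
  shows "ann_rels n (\<lambda>w. \<psi> (x @ w @ y))"
proof -
  have *: "ann_rels n (\<lambda>w. \<psi> (x @ w))"
    unfolding ann_rels_def
    by (intro allI impI) (use \<psi>[unfolded ann_rels_def, rule_format, of "x @ _"] x in simp)
  show ?thesis
    using ann_rels_twist[OF *, of "\<lambda>_ _. y" "\<lambda>_ _. 1"] y by simp
qed

lemma ann_rels_counit: "ann_rels n (\<lambda>w. if w = [] then 1 else 0)"
  by (rule ann_relsI) simp_all

lemma ann_rels_scale: "ann_rels n \<psi> \<Longrightarrow> ann_rels n (\<lambda>w. c * \<psi> w)"
  using ann_rels_twist[of n \<psi> "\<lambda>_ _. []" "\<lambda>_ _. c"] by simp

lemma ann_rels_add:
  assumes "ann_rels n \<psi>" "ann_rels n \<chi>"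
  shows "ann_rels n (\<lambda>w. \<psi> w + \<chi> w)"
proof (rule ann_relsI, goal_cases)
  case (1 u v i j)
  then show ?case
    using ann_rels_anti[OF assms(1) 1] ann_rels_anti[OF assms(2) 1] by simp
next
  case (2 u v i j)
  then show ?case
    using ann_rels_square[OF assms(1) 2] ann_rels_square[OF assms(2) 2] by simp
next
  case (3 u v i j k l)
  then show ?case
    using ann_rels_comm[OF assms(1) 3] ann_rels_comm[OF assms(2) 3] by simp
next
  case (4 u v i j k)
  then show ?case
    using ann_rels_cyclic[OF assms(1) 4] ann_rels_cyclic[OF assms(2) 4] by simp
qed

lemma ann_rels_sum:
  "(\<And>i. i \<in> A \<Longrightarrow> ann_rels n (\<psi> i)) \<Longrightarrow> ann_rels n (\<lambda>w. \<Sum>i\<in>A. \<psi> i w)"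
proof (induction A rule: infinite_finite_induct)
  case (insert x F) then show ?case by (simp add: ann_rels_add)
qed (simp_all add: ann_rels_def)

section \<open>Convolution of functionals\<close>

text \<open>The composite of \<psi> \<otimes> \<chi> with \<Delta>; its value at Q is \<chi> applied
  to \<psi> * Q.\<close>

definition star :: "(word \<Rightarrow> rat) \<Rightarrow> (word \<Rightarrow> rat) \<Rightarrow> word \<Rightarrow> rat" where
  "star \<psi> \<chi> = copsum (\<lambda>L R. \<psi> L * \<chi> R)"

lemma act_Pair: "act \<sigma> (i, j) = (\<sigma> i, \<sigma> j)"
  by (simp add: act_def)

text \<open>This is the well-definedness of the coproduct on E_n. Splitting the outer words first
  reduces it to a short computation for each relation standing in the middle.\<close>

lemma ann_rels_star:
  assumes \<psi>: "ann_rels n \<psi>" and \<chi>: "ann_rels n \<chi>"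
  shows "ann_rels n (star \<psi> \<chi>)"
proof -
  \<comment> \<open>\<open>mid\<close> collects the terms belonging to fixed splittings of the two
    outer words. The left factor of the last word is twisted by the degrees of both earlier right
    factors.\<close>
  define mid where "mid L1 R1 L3 R3 =
    copsum (\<lambda>L R. \<psi> (L1 @ map (act (sigma_w R1)) L @ map (act (sigma_w R1 \<circ> sigma_w R)) L3) * \<chi> (R1 @ R @ R3))"
    for L1 R1 L3 R3
  have split: "star \<psi> \<chi> (u @ m @ v) = copsum (\<lambda>L1 R1. copsum (\<lambda>L3 R3. mid L1 R1 L3 R3 m) v) u" for u m v
    unfolding star_def mid_def copsum_append by (subst copsum_swap) (simp add: comp_def)
  note mid = mid_def copsum_Cons copsum_Nil
  have args: "set L1 \<subseteq> letters n \<and> set R1 \<subseteq> letters n \<and> set L3 \<subseteq> letters n \<and> set R3 \<subseteq> letters n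
      \<and> index_perm n (sigma_w R1)"
    if "set u \<subseteq> letters n" "set v \<subseteq> letters n" "(L1, R1) \<in> set (cops u)" "(L3, R3) \<in> set (cops v)"
    for u v L1 R1 L3 R3
    using that cops_left cops_right by (blast intro: index_perm_sigma_w)
  have act_letters': "set (map (act (\<sigma> \<circ> \<tau>)) L) \<subseteq> letters n" 
    if "index_perm n \<sigma>" "index_perm n \<tau>" "set L \<subseteq> letters n" for \<sigma> \<tau> L
    using that by (intro map_act_letters index_perm_comp)
  have m1: "mid L1 R1 L3 R3 [(i, j)] + mid L1 R1 L3 R3 [(j, i)] = 0"
    if w: "set L1 \<subseteq> letters n" "set R1 \<subseteq> letters n" "set L3 \<subseteq> letters n" "set R3 \<subseteq> letters n"
      and \<sigma>: "index_perm n (sigma_w R1)" and ij: "(i, j) \<in> letters n" for L1 R1 L3 R3 i j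
  proof -
    have "act (sigma_w R1) (i, j) \<in> letters n" using act_letters \<sigma> ij by blast
    from ann_rels_anti[OF \<psi> w(1) map_act_letters[OF \<sigma> w(3)] this[unfolded act_Pair]]
      ann_rels_anti[OF \<chi> w(2,4) ij]
    show ?thesis by (simp add: mid act_Pair transp_swap[of j i])
  qed
  \<comment> \<open>Besides the two squares there are x \<otimes> x and \<sigma>_x(x) \<otimes> x =
    -x \<otimes> x, which cancel.\<close>
  have m2: "mid L1 R1 L3 R3 [(i, j), (i, j)] = 0"
    if w: "set L1 \<subseteq> letters n" "set R1 \<subseteq> letters n" "set L3 \<subseteq> letters n" "set R3 \<subseteq> letters n"
      and \<sigma>: "index_perm n (sigma_w R1)" and ij: "(i, j) \<in> letters n" for L1 R1 L3 R3 i j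
  proof -
    have 1: "(sigma_w R1 i, sigma_w R1 j) \<in> letters n" using act_letters[OF \<sigma> ij] by (simp add: act_Pair)
    have 2: "index_perm n (transp (i, j))" using ij by (rule index_perm_transp)
    have 3: "transp (i, j) i = j" "transp (i, j) j = i" by (auto simp: transp_def)
    from ann_rels_square[OF \<psi> w(1) map_act_letters[OF \<sigma> w(3)] 1]
      ann_rels_anti[OF \<psi> w(1) act_letters'[OF \<sigma> 2 w(3)] 1]
      ann_rels_square[OF \<chi> w(2,4) ij] ij
    show ?thesis by (simp add: mid act_Pair 3)
  qed
  have m3: "mid L1 R1 L3 R3 [(i, j), (k, l)] - mid L1 R1 L3 R3 [(k, l), (i, j)] = 0"
    if w: "set L1 \<subseteq> letters n" "set R1 \<subseteq> letters n" "set L3 \<subseteq> letters n" "set R3 \<subseteq> letters n"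
      and \<sigma>: "index_perm n (sigma_w R1)"
      and ij: "distinct [i, j, k, l]" "(i, j) \<in> letters n" "(k, l) \<in> letters n" for L1 R1 L3 R3 i j k l
  proof -
    have 1: "(sigma_w R1 i, sigma_w R1 j) \<in> letters n" "(sigma_w R1 k, sigma_w R1 l) \<in> letters n"
      using act_letters[OF \<sigma> ij(2)] act_letters[OF \<sigma> ij(3)] by (simp_all add: act_Pair)
    have 2: "distinct [sigma_w R1 i, sigma_w R1 j, sigma_w R1 k, sigma_w R1 l]"
      using ij(1) \<sigma> by (simp add: index_perm_def inj_eq)
    have 3: "transp (i, j) \<circ> transp (k, l) = transp (k, l) \<circ> transp (i, j)"
      using ij(1) by (auto simp: transp_def fun_eq_iff)
    have 4: "transp (i, j) k = k" "transp (i, j) l = l" "transp (k, l) i = i" "transp (k, l) j = j"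
      using ij(1) by (auto simp: transp_def)
    from ann_rels_comm[OF \<psi> w(1) map_act_letters[OF \<sigma> w(3)] 2 1]
      ann_rels_comm[OF \<chi> w(2,4) ij]
    show ?thesis by (simp add: mid act_Pair 4) (simp only: 3 simp_thms)
  qed
  \<comment> \<open>Twisted cross terms such as \<sigma>_ij(x_jk) \<otimes> x_ij = -x_ki \<otimes>
    x_ij cancel the untwisted ones; what remains is the relation in the left factor and the relation
    in the right factor.\<close>
  have m4: "mid L1 R1 L3 R3 [(i, j), (j, k)] + mid L1 R1 L3 R3 [(j, k), (k, i)]
      + mid L1 R1 L3 R3 [(k, i), (i, j)] = 0"
    if w: "set L1 \<subseteq> letters n" "set R1 \<subseteq> letters n" "set L3 \<subseteq> letters n" "set R3 \<subseteq> letters n"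
      and \<sigma>: "index_perm n (sigma_w R1)"
      and ij: "distinct [i, j, k]" "i \<in> {1..n}" "j \<in> {1..n}" "k \<in> {1..n}" for L1 R1 L3 R3 i j k
  proof -
    let ?s = "sigma_w R1"
    have 1: "?s i \<in> {1..n}" "?s j \<in> {1..n}" "?s k \<in> {1..n}"
      using ij(2-4) \<sigma> unfolding index_perm_def by blast+
    have 2: "distinct [?s i, ?s j, ?s k]"
      using ij(1) \<sigma> by (simp add: index_perm_def inj_eq)
    have 3: "(?s i, ?s j) \<in> letters n" "(?s j, ?s k) \<in> letters n" "(?s k, ?s i) \<in> letters n"
      using 1 2 by (simp_all add: letters_iff)
    have l: "index_perm n (transp (i, j))" "index_perm n (transp (j, k))" "index_perm n (transp (k, i))"
      using ij by (auto intro!: index_perm_transp simp: letters_iff)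
    have 4: "transp (i, j) k = k" "transp (i, j) j = i" "transp (j, k) i = i" "transp (j, k) k = j"
      "transp (k, i) j = j" "transp (k, i) i = k"
      using ij(1) by (auto simp: transp_def)
    have 5: "transp (j, k) \<circ> transp (k, i) = transp (i, j) \<circ> transp (j, k)"
      "transp (k, i) \<circ> transp (i, j) = transp (i, j) \<circ> transp (j, k)"
      using ij(1) by (auto simp: transp_def fun_eq_iff)
    have solve: "z = - x - y" if "x + y + z = 0" for x y z :: rat using that by linarith
    note a = ann_rels_anti[OF \<psi> w(1) act_letters'[OF \<sigma> l(1) w(3)] 3(3)]
       ann_rels_anti[OF \<psi> w(1) act_letters'[OF \<sigma> l(2) w(3)] 3(1)]
       ann_rels_anti[OF \<psi> w(1) act_letters'[OF \<sigma> l(3) w(3)] 3(2)]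
    show ?thesis
      using a
        ann_rels_cyclic[OF \<psi> w(1) map_act_letters[OF \<sigma> w(3)] 2 1, THEN solve]
        ann_rels_cyclic[OF \<chi> w(2,4) ij, THEN solve]
      by (simp add: mid act_Pair 4 5 left_diff_distrib right_diff_distrib)
  qed
  show ?thesis
  proof (rule ann_relsI, goal_cases)
    case (1 u v i j)
    have "mid L1 R1 L3 R3 [(i, j)] + mid L1 R1 L3 R3 [(j, i)] = 0"
      if "(L1, R1) \<in> set (cops u)" "(L3, R3) \<in> set (cops v)" for L1 R1 L3 R3
      using args[OF 1(1,2) that] 1(3) by (intro m1) auto
    then show ?case unfolding split copsum_add[symmetric] by (intro copsum_zero)
  next
    case (2 u v i j)
    have "mid L1 R1 L3 R3 [(i, j), (i, j)] = 0"
      if "(L1, R1) \<in> set (cops u)" "(L3, R3) \<in> set (cops v)" for L1 R1 L3 R3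
      using args[OF 2(1,2) that] 2(3) by (intro m2) auto
    then show ?case unfolding split by (intro copsum_zero)
  next
    case (3 u v i j k l)
    have "mid L1 R1 L3 R3 [(i, j), (k, l)] - mid L1 R1 L3 R3 [(k, l), (i, j)] = 0"
      if "(L1, R1) \<in> set (cops u)" "(L3, R3) \<in> set (cops v)" for L1 R1 L3 R3
      using args[OF 3(1,2) that] by (intro m3[OF _ _ _ _ _ 3(3-5)]) auto
    then show ?case unfolding split copsum_diff[symmetric] by (intro copsum_zero)
  next
    case (4 u v i j k)
    have "mid L1 R1 L3 R3 [(i, j), (j, k)] + mid L1 R1 L3 R3 [(j, k), (k, i)]
        + mid L1 R1 L3 R3 [(k, i), (i, j)] = 0"
      if "(L1, R1) \<in> set (cops u)" "(L3, R3) \<in> set (cops v)" for L1 R1 L3 R3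
      using args[OF 4(1,2) that] by (intro m4[OF _ _ _ _ _ 4(3-6)]) auto
    then show ?case unfolding split copsum_add[symmetric] by (intro copsum_zero)
  qed
qed

section \<open>Products in the free algebra and the annihilator of the ideal\<close>

lemma fadd_eq: "fadd f g = f + g"
  by (simp add: fadd_def fun_eq_iff fun_ops)

lemma fsub_eq: "fsub f g = f - g"
  by (simp add: fsub_def fun_eq_iff fun_ops)

lemma fzero_eq: "fzero = 0"
  by (simp add: fzero_def fun_eq_iff fun_ops)

lemmas fa_eqs = fadd_eq fsub_eq fzero_eq

lemma pair_cong: "(\<And>w. w \<in> supp f \<Longrightarrow> \<psi> w = \<chi> w) \<Longrightarrow> pair \<psi> f = pair \<chi> f"
  by (simp add: pair_def)

lemma pair_eq_0: "(\<And>w. w \<in> supp f \<Longrightarrow> \<psi> w = 0) \<Longrightarrow> pair \<psi> f = 0"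
  by (simp add: pair_def)

lemma fmul_conv_sum:
  assumes "finite (supp f)" "finite (supp g)"
  shows "fmul f g = (\<Sum>x\<in>supp f. \<Sum>y\<in>supp g. fsmult (f x * g y) (wrd (x @ y)))"
proof
  fix w :: word
  let ?P = "{p. fst p @ snd p = w}"
  have bij: "bij_betw (\<lambda>k. (take k w, drop k w)) {..length w} ?P"
    by (rule bij_betw_byWitness[where f' = "\<lambda>p. length (fst p)"]) auto
  have finP: "finite ?P" using bij_betw_finite[OF bij] by simp
  have "fmul f g w = (\<Sum>p\<in>?P. f (fst p) * g (snd p))"
    using sum.reindex_bij_betw[OF bij, of "\<lambda>p. f (fst p) * g (snd p)"] by (simp add: fmul_def)
  also have "\<dots> = (\<Sum>p\<in>?P \<inter> (supp f \<times> supp g). f (fst p) * g (snd p))"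
    by (rule sum.mono_neutral_right) (use finP in \<open>auto simp: supp_def\<close>)
  also have "\<dots> = (\<Sum>p\<in>supp f \<times> supp g. if p \<in> ?P then f (fst p) * g (snd p) else 0)"
    using assms by (subst sum.inter_restrict[symmetric]) (auto simp: Int_commute)
  also have "\<dots> = (\<Sum>x\<in>supp f. \<Sum>y\<in>supp g. fsmult (f x * g y) (wrd (x @ y)) w)"
    unfolding sum.cartesian_product by (rule sum.cong) (auto simp: fsmult_def wrd_def)
  finally show "fmul f g w = (\<Sum>x\<in>supp f. \<Sum>y\<in>supp g. fsmult (f x * g y) (wrd (x @ y))) w"
    by (simp add: fa_sum_apply)
qed

lemma pair_fmul:
  assumes "finite (supp f)" "finite (supp g)"
  shows "pair \<psi> (fmul f g) = pair (\<lambda>x. pair (\<lambda>y. \<psi> (x @ y)) g) f"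
  unfolding fmul_conv_sum[OF assms]
  by (simp add: pair_sum finite_supp_sum finite_supp_fsmult pair_fsmult)
     (simp add: pair_def sum_distrib_left mult.assoc)

lemma supp_fmul: "supp (fmul f g) \<subseteq> {x @ y | x y. x \<in> supp f \<and> y \<in> supp g}"
proof
  fix w assume "w \<in> supp (fmul f g)"
  then obtain k where "f (take k w) * g (drop k w) \<noteq> 0"
    unfolding supp_def fmul_def by (metis (mono_tags, lifting) mem_Collect_eq sum.neutral)
  then have "take k w \<in> supp f" "drop k w \<in> supp g" "w = take k w @ drop k w"
    by (auto simp: supp_def)
  then show "w \<in> {x @ y | x y. x \<in> supp f \<and> y \<in> supp g}" by blast
qed

lemma finite_supp_fmul:
  assumes "finite (supp f)" "finite (supp g)"
  shows "finite (supp (fmul f g))"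
proof (rule finite_subset[OF supp_fmul])
  have "{x @ y | x y. x \<in> supp f \<and> y \<in> supp g} = (\<lambda>(x, y). x @ y) ` (supp f \<times> supp g)" by auto
  then show "finite {x @ y | x y. x \<in> supp f \<and> y \<in> supp g}" using assms by simp
qed

definition word_space :: "letter set \<Rightarrow> fa set" where
  "word_space Y = {f. finite (supp f) \<and> (\<forall>w\<in>supp f. set w \<subseteq> Y)}"

lemma FA_eq: "FA n = word_space (letters n)"
  by (simp add: FA_def word_space_def)

lemma word_space_finite: "f \<in> word_space Y \<Longrightarrow> finite (supp f)"
  by (simp add: word_space_def)

lemma word_space_zero [simp]: "0 \<in> word_space Y"
  by (simp add: word_space_def)

lemma word_space_wrd: "set w \<subseteq> Y \<Longrightarrow> wrd w \<in> word_space Y"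
  by (simp add: word_space_def)

lemma word_space_plus: "f \<in> word_space Y \<Longrightarrow> g \<in> word_space Y \<Longrightarrow> f + g \<in> word_space Y"
  using supp_plus[of f g] by (auto simp: word_space_def finite_supp_plus)

lemma word_space_minus: "f \<in> word_space Y \<Longrightarrow> g \<in> word_space Y \<Longrightarrow> f - g \<in> word_space Y"
  using supp_minus[of f g] by (auto simp: word_space_def finite_supp_minus)

lemma word_space_fsmult: "f \<in> word_space Y \<Longrightarrow> fsmult c f \<in> word_space Y"
  using supp_fsmult[of c f] by (auto simp: word_space_def finite_supp_fsmult)

lemma word_space_sum: "(\<And>i. i \<in> A \<Longrightarrow> f i \<in> word_space Y) \<Longrightarrow> (\<Sum>i\<in>A. f i) \<in> word_space Y"
  by (induction A rule: infinite_finite_induct) (auto intro: word_space_plus)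

lemma word_space_fmul:
  assumes "f \<in> word_space Y" "g \<in> word_space Y"
  shows "fmul f g \<in> word_space Y"
  using assms supp_fmul[of f g] finite_supp_fmul[of f g] unfolding word_space_def by fastforce

lemma subspace_word_space: "fa.subspace (word_space Y)"
  by (auto intro!: fa.subspaceI word_space_plus word_space_fsmult)

lemma Ideal_FA: "r \<in> Ideal n \<Longrightarrow> r \<in> word_space (letters n)"
proof (induction rule: Ideal.induct)
  case (gen r)
  then show ?case unfolding rels_def fa_eqs
    by (auto intro!: word_space_wrd word_space_plus word_space_minus simp: letters_iff)
qed (auto simp: fa_eqs intro: word_space_plus word_space_fsmult word_space_fmul word_space_wrd)

lemma Ideal_finite: "r \<in> Ideal n \<Longrightarrow> finite (supp r)"
  using Ideal_FA word_space_finite by blast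

lemma subspace_Ideal: "fa.subspace (Ideal n)"
  using Ideal.zero Ideal.add Ideal.smult by (auto intro!: fa.subspaceI simp: fa_eqs)

lemma span_Ideal [simp]: "fa.span (Ideal n) = Ideal n"
  using subspace_Ideal by (simp add: fa.span_eq_iff)

text \<open>Induction with the functional left arbitrary: multiplying by a word translates the
  functional, and translates stay in \<open>ann_rels\<close>.\<close>

lemma pair_Ideal:
  "r \<in> Ideal n \<Longrightarrow> ann_rels n \<psi> \<Longrightarrow> pair \<psi> r = 0"
proof (induction arbitrary: \<psi> rule: Ideal.induct)
  case (gen r)
  note ann = ann_rels_anti[OF gen(2), of "[]" "[]"] ann_rels_square[OF gen(2), of "[]" "[]"]
    ann_rels_comm[OF gen(2), of "[]" "[]"] ann_rels_cyclic[OF gen(2), of "[]" "[]"]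
  show ?case using gen(1) unfolding rels_def fa_eqs
  proof (elim UnE, goal_cases)
    case 1
    then obtain i j where r: "r = wrd [(i, j)] + wrd [(j, i)]" "(i, j) \<in> letters n" by blast
    show ?case using ann(1)[OF _ _ r(2)] by (simp add: r(1) pair_plus)
  next
    case 2
    then obtain i j where r: "r = wrd [(i, j), (i, j)]" "(i, j) \<in> letters n" by blast
    show ?case using ann(2)[OF _ _ r(2)] by (simp add: r(1))
  next
    case 3
    then obtain i j k l where r: "r = wrd [(i, j), (k, l)] - wrd [(k, l), (i, j)]"
      "distinct [i, j, k, l]" "(i, j) \<in> letters n" "(k, l) \<in> letters n" by blast
    show ?case using ann(3)[OF _ _ r(2-4)] by (simp add: r(1) pair_minus)
  next
    case 4
    then obtain i j k where r:
      "r = wrd [(i, j), (j, k)] + wrd [(j, k), (k, i)] + wrd [(k, i), (i, j)]"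
      "distinct [i, j, k]" "i \<in> {1..n}" "j \<in> {1..n}" "k \<in> {1..n}" by blast
    show ?case using ann(4)[OF _ _ r(2-5)] by (simp add: r(1) pair_plus finite_supp_plus)
  qed
next
  case (lmul a u)
  then show ?case using ann_rels_shift[OF lmul.prems, of u "[]"]
    by (simp add: pair_fmul Ideal_finite)
next
  case (rmul a u)
  then show ?case using ann_rels_shift[OF rmul.prems, of "[]" u]
    by (simp add: pair_fmul Ideal_finite)
qed (simp_all add: fa_eqs pair_plus pair_fsmult Ideal_finite)

text \<open>A relation between \<open>u\<close> and \<open>v\<close> is the product of
  \<open>wrd u\<close>, the relation and \<open>wrd v\<close>, hence in the ideal. Together with
  \<open>pair_Ideal\<close> this identifies \<open>ann_rels\<close> with the annihilator of the
  ideal.\<close>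

lemma ann_rels_if_pair_Ideal:
  assumes "\<And>r. r \<in> Ideal n \<Longrightarrow> pair \<psi> r = 0"
  shows "ann_rels n \<psi>"
proof -
  have *: "pair (\<lambda>w. \<psi> (u @ w @ v)) r = 0"
    if "r \<in> rels n" "set u \<subseteq> letters n" "set v \<subseteq> letters n" for r u v
  proof -
    have r: "r \<in> Ideal n" using that by (simp add: Ideal.gen)
    have "fmul (wrd u) (fmul r (wrd v)) \<in> Ideal n"
      using that by (intro Ideal.intros)
    then show ?thesis using assms Ideal_finite[OF r]
      by (metis (no_types, lifting) ext finite.emptyI finite.insertI finite_supp_fmul pair_fmul pair_wrd supp_wrd)
  qed
  show ?thesis
  proof (rule ann_relsI, goal_cases)
    case (1 u v i j)
    then have "fadd (wrd [(i,j)]) (wrd [(j,i)]) \<in> rels n" unfolding rels_def by blast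
    from *[OF this 1(1,2)] show ?case by (simp add: fa_eqs pair_plus)
  next
    case (2 u v i j)
    then have "wrd [(i,j),(i,j)] \<in> rels n" unfolding rels_def by blast
    from *[OF this 2(1,2)] show ?case by simp
  next
    case (3 u v i j k l)
    then have "fsub (wrd [(i,j),(k,l)]) (wrd [(k,l),(i,j)]) \<in> rels n" unfolding rels_def by blast
    from *[OF this 3(1,2)] show ?case by (simp add: fa_eqs pair_minus)
  next
    case (4 u v i j k)
    then have "fadd (fadd (wrd [(i,j),(j,k)]) (wrd [(j,k),(k,i)])) (wrd [(k,i),(i,j)]) \<in> rels n"
      unfolding rels_def by blast
    from *[OF this 4(1,2)] show ?case by (simp add: fa_eqs pair_plus finite_supp_plus)
  qed
qed

subsection \<open>Functionals on the quotients by the augmentation ideal\<close>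

text \<open>For X inside Y the words \<open>t # w\<close> span E_X^+ E_Y modulo the relations, so
  restriction to E_Y gives functionals on E_Y / E_X^+ E_Y. Taking \<open>letters n\<close> for Y
  gives the dual of C, taking the letters of G gives functionals on A.\<close>

definition coset_ann :: "nat \<Rightarrow> letter set \<Rightarrow> letter set \<Rightarrow> (word \<Rightarrow> rat) \<Rightarrow> bool" where
  "coset_ann n X Y \<psi> \<longleftrightarrow> ann_rels n \<psi> \<and> (\<forall>t\<in>X. \<forall>w. set w \<subseteq> Y \<longrightarrow> \<psi> (t # w) = 0)"

lemma coset_annD: "coset_ann n X Y \<psi> \<Longrightarrow> t \<in> X \<Longrightarrow> set w \<subseteq> Y \<Longrightarrow> \<psi> (t # w) = 0"
  by (simp add: coset_ann_def)

lemma coset_ann_rels: "coset_ann n X Y \<psi> \<Longrightarrow> ann_rels n \<psi>"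
  by (simp add: coset_ann_def)

lemma coset_ann_restrict:
  "coset_ann n X Y \<psi> \<Longrightarrow> coset_ann n X Y (\<lambda>w. if P (length w) (sigma_w w) then \<psi> w else 0)"
  by (simp add: coset_ann_def ann_rels_restrict)

lemma coset_ann_counit: "coset_ann n X Y (\<lambda>w. if w = [] then 1 else 0)"
  by (simp add: coset_ann_def ann_rels_counit)

lemma coset_ann_sum:
  "(\<And>i. i \<in> A \<Longrightarrow> coset_ann n X Y (\<psi> i)) \<Longrightarrow> coset_ann n X Y (\<lambda>w. \<Sum>i\<in>A. \<psi> i w)"
  by (simp add: coset_ann_def ann_rels_sum)

lemma coset_ann_scale: "coset_ann n X Y \<psi> \<Longrightarrow> coset_ann n X Y (\<lambda>w. c * \<psi> w)"
  by (simp add: coset_ann_def ann_rels_scale)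

text \<open>This is the C-comodule structure of A in dual form: a first letter from X goes either to
  the left, where \<psi> kills it, or to the right, where \<chi> does.\<close>

lemma coset_ann_star:
  assumes \<psi>: "coset_ann n X (letters n) \<psi>" and \<chi>: "coset_ann n X Y \<chi>" and Y: "Y \<subseteq> letters n"
  shows "coset_ann n X Y (star \<psi> \<chi>)"
  unfolding coset_ann_def
proof (intro conjI ballI allI impI)
  show "ann_rels n (star \<psi> \<chi>)" using \<psi> \<chi> by (intro ann_rels_star) (auto simp: coset_ann_def)
  fix t w assume t: "t \<in> X" and w: "set w \<subseteq> Y"
  have "copsum (\<lambda>L R. \<psi> (t # L) * \<chi> R) w = 0"
    by (rule copsum_zero) (use cops_left[of _ _ w n] w Y t coset_annD[OF \<psi>] in auto)
  moreover have "copsum (\<lambda>L R. \<psi> (map (act (transp t)) L) * \<chi> (t # R)) w = 0"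
  proof (rule copsum_zero)
    fix L R assume "(L, R) \<in> set (cops w)"
    then have "set R \<subseteq> Y" using cops_right w by blast
    then show "\<psi> (map (act (transp t)) L) * \<chi> (t # R) = 0" using coset_annD[OF \<chi> t] by simp
  qed
  ultimately show "star \<psi> \<chi> (t # w) = 0" by (simp add: star_def)
qed

section \<open>Freeness of E_n over E_Y and the embedding of A into C\<close>

text \<open>Words whose classes form a basis of \<open>\<E>\<^sub>n / \<E>\<^sub>G\<^sup>+ \<E>\<^sub>n\<close>, hence of \<open>\<E>\<^sub>n\<close> over \<open>\<E>\<^sub>G\<close>; only
  triangularity with respect to an enumeration of all words is needed.\<close>

definition coset_words :: "nat \<Rightarrow> letter set \<Rightarrow> word set" where
  "coset_words n Y = {w. set w \<subseteq> letters n \<and> (\<exists>\<psi>. coset_ann n Y (letters n) \<psi> \<and> \<psi> w \<noteq> 0 \<and>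
     (\<forall>v. set v \<subseteq> letters n \<longrightarrow> to_nat v < to_nat w \<longrightarrow> \<psi> v = 0))}"

lemma Nil_coset_words: "[] \<in> coset_words n Y"
  using coset_ann_counit[of n Y "letters n"] unfolding coset_words_def by force

text \<open>By induction on the length, \<psi> vanishes on words of the given length that begin in
  Y, so its part of that length lies in \<open>coset_ann\<close>. The first word of the enumeration
  where this part is nonzero would be a coset word, which the hypothesis excludes for empty
  \<open>g\<close>.\<close>

lemma coset_words_spanning:
  assumes Y: "Y \<subseteq> letters n"
  shows "ann_rels n \<psi> \<Longrightarrow> (\<And>g v. set g \<subseteq> Y \<Longrightarrow> v \<in> coset_words n Y \<Longrightarrow> \<psi> (g @ v) = 0) \<Longrightarrow>
    set w \<subseteq> letters n \<Longrightarrow> \<psi> w = 0"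
proof (induction "length w" arbitrary: w \<psi> rule: less_induct)
  case less
  define \<psi>' where "\<psi>' v = (if length v = length w then \<psi> v else 0)" for v
  have "coset_ann n Y (letters n) \<psi>'"
    unfolding coset_ann_def
  proof (intro conjI ballI allI impI)
    show "ann_rels n \<psi>'"
      using ann_rels_restrict[OF less.prems(1), of "\<lambda>k _. k = length w"] by (simp add: \<psi>'_def[abs_def])
    fix t v assume t: "t \<in> Y" and v: "set v \<subseteq> letters n"
    show "\<psi>' (t # v) = 0"
    proof (cases "length (t # v) = length w")
      case True
      have "\<psi> ([t] @ v @ []) = 0"
      proof (rule less.hyps[of v "\<lambda>v. \<psi> ([t] @ v @ [])"])
        show "length v < length w" using True by simp
        show "ann_rels n (\<lambda>v. \<psi> ([t] @ v @ []))"
          using less.prems(1) t Y by (intro ann_rels_shift) auto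
        show "\<psi> ([t] @ (g @ v') @ []) = 0" if "set g \<subseteq> Y" "v' \<in> coset_words n Y" for g v'
          using less.prems(2)[of "t # g" v'] that t by simp
      qed (fact v)
      then show ?thesis by (simp add: \<psi>'_def)
    qed (simp add: \<psi>'_def)
  qed
  note \<psi>' = this
  have "\<psi>' v = 0" if "set v \<subseteq> letters n" for v
    using that
  proof (induction "to_nat v" arbitrary: v rule: less_induct)
    case (less v)
    show ?case
    proof (rule ccontr)
      assume "\<psi>' v \<noteq> 0"
      then have "v \<in> coset_words n Y" unfolding coset_words_def using less \<psi>' by blast
      then show False using \<open>\<psi>' v \<noteq> 0\<close> \<open>\<And>g v. set g \<subseteq> Y \<Longrightarrow> v \<in> coset_words n Y \<Longrightarrow> \<psi> (g @ v) = 0\<close>[of "[]" v]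
        by (auto simp: \<psi>'_def split: if_splits)
    qed
  qed
  from this[OF less.prems(3)] show ?case by (simp add: \<psi>'_def)
qed

text \<open>Coset words are independent over E_Y. Among the words with nonzero coefficient, take
  those of maximal length and of these the last, \<open>w\<close>; convolving with the functional
  that witnesses \<open>w\<close> isolates the coefficient \<open>p w\<close>.\<close>

lemma coset_words_unique:
  assumes Y: "Y \<subseteq> letters n" and T: "finite T" "T \<subseteq> coset_words n Y"
    and p: "\<And>v. v \<in> T \<Longrightarrow> p v \<in> word_space Y"
    and rel: "\<And>\<psi>. ann_rels n \<psi> \<Longrightarrow> (\<Sum>v\<in>T. pair (\<lambda>g. \<psi> (g @ v)) (p v)) = 0"
    and v: "v \<in> T" and \<chi>: "ann_rels n \<chi>"
  shows "pair \<chi> (p v) = 0"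
proof (rule ccontr)
  assume nz: "pair \<chi> (p v) \<noteq> 0"
  define bad where "bad = {v\<in>T. \<exists>\<chi>. ann_rels n \<chi> \<and> pair \<chi> (p v) \<noteq> 0}"
  have "v \<in> bad" using nz v \<chi> by (auto simp: bad_def)
  have fin: "finite bad" using T by (simp add: bad_def)
  define D where "D = Max (length ` bad)"
  have D: "length u \<le> D" if "u \<in> bad" for u
    unfolding D_def using fin that by simp
  define bad' where "bad' = {u\<in>bad. length u = D}"
  have "D \<in> length ` bad" unfolding D_def using fin \<open>v \<in> bad\<close> by (intro Max_in) auto
  then have ne: "bad' \<noteq> {}" by (auto simp: bad'_def)
  have fin': "finite bad'" using fin by (simp add: bad'_def)
  obtain w where w: "w \<in> bad'" "to_nat w = Max (to_nat ` bad')"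
    using Max_in[of "to_nat ` bad'"] ne fin' by (metis finite_imageI image_iff image_is_empty)
  have wmax: "to_nat u < to_nat w" if "u \<in> bad'" "u \<noteq> w" for u
    using that w fin' by (metis Max_ge finite_imageI image_eqI inj_to_nat injD le_neq_implies_less)
  have wT: "w \<in> T" and lw: "length w = D" using w by (auto simp: bad'_def bad_def)
  obtain \<chi> where \<chi>: "ann_rels n \<chi>" "pair \<chi> (p w) \<noteq> 0" using w by (auto simp: bad'_def bad_def)
  obtain \<xi>0 where \<xi>0: "coset_ann n Y (letters n) \<xi>0" "\<xi>0 w \<noteq> 0"
    "\<And>v. set v \<subseteq> letters n \<Longrightarrow> to_nat v < to_nat w \<Longrightarrow> \<xi>0 v = 0"
    using wT T unfolding coset_words_def by blast
  \<comment> \<open>The restriction to the maximal length \<open>D\<close> is the top-degree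
    projection of the right tensor factor.\<close>
  define \<xi> where "\<xi> u = (if length u = D then \<xi>0 u else 0)" for u
  have \<xi>: "coset_ann n Y (letters n) \<xi>"
    using coset_ann_restrict[OF \<xi>0(1), of "\<lambda>k _. k = D"] by (simp add: \<xi>_def[abs_def])
  have words: "set u \<subseteq> letters n" if "u \<in> T" for u
    using that T by (auto simp: coset_words_def)
  \<comment> \<open>\<xi> kills every word that begins in Y, so no letter of \<open>g\<close> can go
    to the right.\<close>
  have \<eta>: "star \<chi> \<xi> (g @ u) = copsum (\<lambda>L R. \<chi> (g @ L) * \<xi> R) u" if "set g \<subseteq> Y" "u \<in> T" for g u
  proof -
    have "copsum (\<lambda>L' R'. \<chi> (L @ map (act (sigma_w R)) L') * \<xi> (R @ R')) u = 0"
      if "(L, R) \<in> set (cops g)" "R \<noteq> []" for L R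
    proof (rule copsum_zero)
      fix L' R' assume "(L', R') \<in> set (cops u)"
      then have "set R' \<subseteq> letters n" using cops_right words[OF \<open>u \<in> T\<close>] by blast
      moreover have "set R \<subseteq> Y" using cops_right that(1) \<open>set g \<subseteq> Y\<close> by blast
      ultimately have "\<xi> (R @ R') = 0"
        using that(2) coset_annD[OF \<xi>, of "hd R" "tl R @ R'"] Y by (cases R) auto
      then show "\<chi> (L @ map (act (sigma_w R)) L') * \<xi> (R @ R') = 0" by simp
    qed
    then have "copsum (\<lambda>L R. if R = [] then 0 else
        copsum (\<lambda>L' R'. \<chi> (L @ map (act (sigma_w R)) L') * \<xi> (R @ R')) u) g = 0"
      by (intro copsum_zero) auto
    then show ?thesis
      unfolding star_def copsum_append by (subst copsum_split_right_Nil) simp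
  qed
  have pair_copsum: "pair (\<lambda>g. star \<chi> \<xi> (g @ u)) (p u) = copsum (\<lambda>L R. pair (\<lambda>g. \<chi> (g @ L)) (p u) * \<xi> R) u"
    if "u \<in> T" for u
  proof -
    have "pair (\<lambda>g. star \<chi> \<xi> (g @ u)) (p u) = pair (\<lambda>g. copsum (\<lambda>L R. \<chi> (g @ L) * \<xi> R) u) (p u)"
      using p[OF that] that by (intro pair_cong \<eta>) (auto simp: word_space_def)
    then show ?thesis
      by (simp add: pair_def sum_distrib_right copsum_sum copsum_mult_left mult.assoc)
  qed
  \<comment> \<open>If \<open>u\<close> has zero coefficient, so does every translate. Otherwise
    \<xi> requires a right factor of length \<open>D\<close>, so all of \<open>u\<close> goes right,
    and \<xi> vanishes there because \<open>u\<close> comes before \<open>w\<close>.\<close>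
  have zero: "pair (\<lambda>g. star \<chi> \<xi> (g @ u)) (p u) = 0" if u: "u \<in> T" "u \<noteq> w" for u
  proof -
    have "pair (\<lambda>g. \<chi> (g @ L)) (p u) * \<xi> R = 0" if LR: "(L, R) \<in> set (cops u)" for L R
    proof (cases "u \<in> bad")
      case False
      have "ann_rels n (\<lambda>g. \<chi> ([] @ g @ L))"
        using cops_left[OF LR] words[OF u(1)] \<chi> by (intro ann_rels_shift) auto
      then show ?thesis using False u by (auto simp: bad_def)
    next
      case True
      have "\<xi> R = 0"
      proof (cases "length R = D")
        case len: True
        then have "length L = 0" "length u = D" using cops_length[OF LR] D[OF True] by linarith+
        then have "R = u" using LR cops_Nil_left by simp
        then show ?thesis using \<xi>0(3) wmax u True \<open>length u = D\<close> words by (auto simp: \<xi>_def bad'_def)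
      qed (simp add: \<xi>_def)
      then show ?thesis by simp
    qed
    then show ?thesis unfolding pair_copsum[OF u(1)] by (intro copsum_zero)
  qed
  have "pair (\<lambda>g. star \<chi> \<xi> (g @ w)) (p w) = pair \<chi> (p w) * \<xi> w"
  proof -
    have "copsum (\<lambda>L R. if L = [] then 0 else pair (\<lambda>g. \<chi> (g @ L)) (p w) * \<xi> R) w = 0"
      by (rule copsum_zero) (use cops_length lw in \<open>fastforce simp: \<xi>_def\<close>)
    then show ?thesis unfolding pair_copsum[OF wT] by (subst copsum_split_left_Nil) simp
  qed
  then have "(\<Sum>v\<in>T. pair (\<lambda>g. star \<chi> \<xi> (g @ v)) (p v)) = pair \<chi> (p w) * \<xi> w"
    using zero wT T(1) by (subst sum.remove[of T w]) (auto intro: sum.neutral)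
  moreover have "\<dots> \<noteq> 0" using \<chi> \<xi>0(2) lw by (simp add: \<xi>_def)
  ultimately show False
    using rel[OF ann_rels_star[OF \<chi>(1) coset_ann_rels[OF \<xi>]]] by simp
qed

text \<open>This is the injectivity of A \<rightarrow> C. An element of E_Y lying in E_X^+ E_n is
  expanded in the coset words for Y; comparing coefficients at the empty word puts it in E_X^+
  E_Y.\<close>

lemma coset_ann_extension:
  assumes XY: "X \<subseteq> Y" and Y: "Y \<subseteq> letters n" and x: "x \<in> word_space Y"
    and ann: "\<And>\<psi>. coset_ann n X (letters n) \<psi> \<Longrightarrow> pair \<psi> x = 0"
    and \<chi>: "coset_ann n X Y \<chi>"
  shows "pair \<chi> x = 0"
proof -
  \<comment> \<open>By \<open>coset_words_spanning\<close> applied after a first letter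
    \<open>t\<close>, these words span E_X^+ E_n modulo the ideal.\<close>
  define W where "W = {wrd (t # g @ v) | t g v. t \<in> X \<and> set g \<subseteq> Y \<and> v \<in> coset_words n Y}"
  have finW: "finite (supp a)" if "a \<in> fa.span W" for a
  proof -
    have "a \<in> word_space UNIV"
      using fa.span_minimal[OF _ subspace_word_space, of W UNIV] that
      by (auto simp: W_def intro: word_space_wrd)
    then show ?thesis by (rule word_space_finite)
  qed
  have "x \<in> fa.span (Ideal n \<union> W)"
  proof (rule double_annihilator)
    show "fa.subspace (fa.span (Ideal n \<union> W))" by (rule fa.subspace_span)
    show "finite (supp x)" using x by (rule word_space_finite)
    show "finite (supp u)" if "u \<in> fa.span (Ideal n \<union> W)" for u
      using that finW Ideal_finite[of _ n]
      by (auto simp: fa.span_Un intro!: finite_supp_plus)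
    fix \<psi> assume \<psi>: "\<And>u. u \<in> fa.span (Ideal n \<union> W) \<Longrightarrow> pair \<psi> u = 0"
    have 1: "ann_rels n \<psi>" by (rule ann_rels_if_pair_Ideal) (use \<psi> fa.span_base in blast)
    have 2: "\<psi> (t # g @ v) = 0" if "t \<in> X" "set g \<subseteq> Y" "v \<in> coset_words n Y" for t g v
    proof -
      have "wrd (t # g @ v) \<in> Ideal n \<union> W" using that unfolding W_def by blast
      from \<psi>[OF fa.span_base[OF this]] show ?thesis by simp
    qed
    have "\<psi> (t # w) = 0" if "t \<in> X" "set w \<subseteq> letters n" for t w
      using coset_words_spanning[OF Y ann_rels_shift[OF 1, of "[t]" "[]"], of w] 2 that XY Y by auto
    then show "pair \<psi> x = 0" using 1 by (intro ann) (auto simp: coset_ann_def)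
  qed
  then obtain i y where xiy: "x = i + y" and i: "i \<in> Ideal n" and y: "y \<in> fa.span W"
    by (auto simp: fa.span_Un)
  obtain S r where S: "finite S" "S \<subseteq> W" and yS: "y = (\<Sum>a\<in>S. fsmult (r a) a)"
    using y unfolding fa.span_explicit by blast
  have "\<forall>a\<in>S. \<exists>s v. a = wrd (s @ v) \<and> v \<in> coset_words n Y \<and> set s \<subseteq> Y \<and> \<chi> s = 0"
  proof
    fix a assume "a \<in> S"
    then obtain t g v where "a = wrd (t # g @ v)" "t \<in> X" "set g \<subseteq> Y" "v \<in> coset_words n Y"
      using S by (auto simp: W_def)
    then show "\<exists>s v. a = wrd (s @ v) \<and> v \<in> coset_words n Y \<and> set s \<subseteq> Y \<and> \<chi> s = 0"
      using coset_annD[OF \<chi>] XY by (intro exI[of _ "t # g"] exI[of _ v]) auto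
  qed
  then obtain s v where sv: "\<And>a. a \<in> S \<Longrightarrow> a = wrd (s a @ v a) \<and> v a \<in> coset_words n Y \<and> set (s a) \<subseteq> Y \<and> \<chi> (s a) = 0"
    by metis
  \<comment> \<open>\<open>p u\<close> is the E_Y-coefficient of the coset word \<open>u\<close> in
    \<open>y - x\<close>, which is zero in E_n.\<close>
  define p where "p u = (\<Sum>a\<in>S. fsmult (if v a = u then r a else 0) (wrd (s a))) - fsmult (if u = [] then 1 else 0) x" for u
  have pair_p: "pair \<phi> (p u) = (\<Sum>a\<in>S. (if v a = u then r a else 0) * \<phi> (s a)) - (if u = [] then 1 else 0) * pair \<phi> x"
    for \<phi> u
    unfolding p_def using word_space_finite[OF x]
    by (simp add: pair_minus pair_sum pair_fsmult finite_supp_sum finite_supp_fsmult)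
  \<comment> \<open>The empty word is put in explicitly, since \<open>x\<close> itself contributes
    to its coefficient.\<close>
  define T where "T = insert [] (v ` S)"
  have "pair \<chi> (p []) = 0"
  proof (rule coset_words_unique[OF Y])
    show "finite T" "T \<subseteq> coset_words n Y" "[] \<in> T" using S sv Nil_coset_words by (auto simp: T_def)
    show "p u \<in> word_space Y" for u
      unfolding p_def using sv x
      by (intro word_space_minus word_space_sum word_space_fsmult word_space_wrd) auto
    show "ann_rels n \<chi>" using \<chi> by (rule coset_ann_rels)
    fix \<psi> assume \<psi>: "ann_rels n \<psi>"
    have "(\<Sum>u\<in>T. pair (\<lambda>g. \<psi> (g @ u)) (p u)) =
      (\<Sum>u\<in>T. \<Sum>a\<in>S. (if v a = u then r a else 0) * \<psi> (s a @ u)) -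
      (\<Sum>u\<in>T. (if u = [] then 1 else 0) * pair (\<lambda>g. \<psi> (g @ u)) x)"
      by (simp add: pair_p sum_subtractf)
    also have "(\<Sum>u\<in>T. (if u = [] then 1 else 0) * pair (\<lambda>g. \<psi> (g @ u)) x) = (\<Sum>u\<in>T. if u = [] then pair \<psi> x else 0)"
      by (rule sum.cong) auto
    also have "\<dots> = pair \<psi> x"
      using S by (simp add: T_def)
    also have "(\<Sum>u\<in>T. \<Sum>a\<in>S. (if v a = u then r a else 0) * \<psi> (s a @ u)) =
       (\<Sum>a\<in>S. \<Sum>u\<in>T. if v a = u then r a * \<psi> (s a @ v a) else 0)"
      by (subst sum.swap) (auto intro!: sum.cong)
    also have "\<dots> = (\<Sum>a\<in>S. r a * \<psi> (s a @ v a))"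
      using S by (auto simp: T_def intro!: sum.cong)
    also have "\<dots> = pair \<psi> y"
    proof -
      have "finite (supp a)" "pair \<psi> a = \<psi> (s a @ v a)" if "a \<in> S" for a
        using sv[OF that] by (metis finite.emptyI finite.insertI supp_wrd, metis pair_wrd)
      then show ?thesis
        unfolding yS by (subst pair_sum) (auto simp: finite_supp_fsmult pair_fsmult intro!: sum.cong)
    qed
    also have "pair \<psi> x = pair \<psi> y"
      unfolding xiy using i y finW by (simp add: pair_plus Ideal_finite pair_Ideal[OF _ \<psi>])
    finally show "(\<Sum>u\<in>T. pair (\<lambda>g. \<psi> (g @ u)) (p u)) = 0" by simp
  qed
  then show ?thesis using sv by (simp add: pair_p)
qed

section \<open>The braided product formula and the top-degree form\<close>

lemma pair_copsum:
  "pair (\<lambda>w. copsum (h w) g) a = copsum (\<lambda>L R. pair (\<lambda>w. h w L R) a) g"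
  by (simp add: pair_def copsum_sum copsum_mult_left)

lemma coset_ann_uminus: "coset_ann n X Y \<psi> \<Longrightarrow> coset_ann n X Y (\<lambda>w. - \<psi> w)"
  using coset_ann_scale[of n X Y \<psi> "- 1"] by simp

lemma coset_ann_zero: "coset_ann n X Y (\<lambda>_. 0)"
  using coset_ann_scale[OF coset_ann_counit, of n X Y 0] by simp

lemma coset_ann_copsum:
  assumes "\<And>L R. (L, R) \<in> set (cops g) \<Longrightarrow> coset_ann n X Y (f L R)"
  shows "coset_ann n X Y (\<lambda>w. copsum (\<lambda>L R. f L R w) g)"
proof -
  have "coset_ann n X Y (\<lambda>w. \<Sum>p\<leftarrow>ps. f (fst p) (snd p) w)"
    if "\<And>p. p \<in> set ps \<Longrightarrow> coset_ann n X Y (f (fst p) (snd p))" for ps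
    using that
  proof (induction ps)
    case (Cons p ps)
    then show ?case by (simp add: coset_ann_def ann_rels_add)
  qed (simp add: coset_ann_zero)
  from this[of "cops g"] assms show ?thesis unfolding copsum_def by simp
qed

text \<open>Functional \<open>P \<mapsto> q (P \<cdot> \<sigma>\<^sub>P\<^sup>-\<^sup>1 \<kappa> (L))\<close>. On a tensor \<open>P \<otimes> Q\<close> of \<open>S\<^sub>n\<close>-degree \<open>\<kappa>\<close> the
  permutation \<open>\<sigma>\<^sub>P\<^sup>-\<^sup>1 \<kappa>\<close> is \<open>\<sigma>\<^sub>Q\<close>, the braiding in the product formula for the coproduct.\<close>

definition braid :: "(nat \<Rightarrow> nat) \<Rightarrow> word \<Rightarrow> (word \<Rightarrow> rat) \<Rightarrow> word \<Rightarrow> rat" where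
  "braid \<kappa> L q = (\<lambda>c. q (c @ map (act (inv (sigma_w c) \<circ> \<kappa>)) L))"

text \<open>The appended word depends on \<open>c\<close> only through its S_n-degree, so
  \<open>ann_rels_twist\<close> applies; appending on the right leaves a first letter from X in
  place.\<close>

lemma coset_ann_braid:
  assumes q: "coset_ann n X (letters n) q" and L: "set L \<subseteq> letters n" and \<kappa>: "index_perm n \<kappa>"
    and X: "X \<subseteq> letters n"
  shows "coset_ann n X (letters n) (braid \<kappa> L q)"
proof -
  have E: "set (map (act (inv (sigma_w u) \<circ> \<kappa>)) L) \<subseteq> letters n" if "set u \<subseteq> letters n" for u
    unfolding inv_sigma_w using that L \<kappa> by (intro map_act_letters index_perm_comp index_perm_sigma_w) auto
  have "ann_rels n (braid \<kappa> L q)"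
    unfolding braid_def
    using ann_rels_twist[OF coset_ann_rels[OF q], of "\<lambda>_ \<sigma>. map (act (inv \<sigma> \<circ> \<kappa>)) L" "\<lambda>_ _. 1"] E
    by simp
  moreover have "braid \<kappa> L q (t # w) = 0" if "t \<in> X" "set w \<subseteq> letters n" for t w
    using coset_annD[OF q that(1), of "w @ map (act (inv (sigma_w (t # w)) \<circ> \<kappa>)) L"] E[of "t # w"] that X
    by (auto simp: braid_def)
  ultimately show ?thesis by (simp add: coset_ann_def)
qed

text \<open>The product formula, expanded over the splittings of \<open>g\<close>. The isolated term
  is (q * w) g; in all others the remaining right factor is shorter than \<open>g\<close>, which
  permits induction on the length of \<open>g\<close>.\<close>

lemma star_append:
  "star q \<chi> (w @ g) = copsum (\<lambda>L R. q L * \<chi> (R @ g)) w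
     + copsum (\<lambda>L' R'. if L' = [] then 0
         else copsum (\<lambda>L R. braid (sigma_w w) L' q L * \<chi> (R @ R')) w) g"
proof -
  have "star q \<chi> (w @ g) =
      copsum (\<lambda>L' R'. copsum (\<lambda>L R. q (L @ map (act (sigma_w R)) L') * \<chi> (R @ R')) w) g"
    unfolding star_def copsum_append by (rule copsum_swap)
  also have "\<dots> = copsum (\<lambda>L' R'. copsum (\<lambda>L R. braid (sigma_w w) L' q L * \<chi> (R @ R')) w) g"
    by (intro copsum_cong) (simp add: braid_def cops_sigma_right)
  also have "\<dots> = copsum (\<lambda>L R. braid (sigma_w w) [] q L * \<chi> (R @ g)) w
     + copsum (\<lambda>L' R'. if L' = [] then 0
         else copsum (\<lambda>L R. braid (sigma_w w) L' q L * \<chi> (R @ R')) w) g"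
    by (rule copsum_split_left_Nil)
  finally show ?thesis by (simp add: braid_def)
qed

text \<open>The number \<open>d\<close> is the top degree of A and \<phi> is homogeneous for both
  gradings. Concentration in one S_n-degree makes the radical of the form S_n-graded, so
  \<open>braid\<close> can be used with a fixed permutation.\<close>

locale coset_top =
  fixes n :: nat and X Y :: "letter set" and d :: nat and \<phi> :: "word \<Rightarrow> rat" and w0 :: word
  assumes XY: "X \<subseteq> Y" and Y: "Y \<subseteq> letters n"
    and \<phi>: "coset_ann n X Y \<phi>"
    and \<phi>_supp: "\<And>w. \<phi> w \<noteq> 0 \<Longrightarrow> length w = d \<and> sigma_w w = sigma_w w0"
    and w0: "set w0 \<subseteq> Y" "\<phi> w0 \<noteq> 0"
    and top: "\<And>\<chi> w. coset_ann n X Y \<chi> \<Longrightarrow> set w \<subseteq> Y \<Longrightarrow> d < length w \<Longrightarrow> \<chi> w = 0"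
begin

lemma length_w0: "length w0 = d"
  using \<phi>_supp w0 by blast

lemma X: "X \<subseteq> letters n"
  using XY Y by blast

text \<open>Above degree \<open>d\<close> every coset functional vanishes. In degrees up to
  \<open>d\<close> a nonempty left factor leaves too few letters for \<phi>, and the empty one is
  killed by \<open>q\<close>.\<close>

lemma star_top_eq_0:
  assumes q: "coset_ann n X (letters n) q" "q [] = 0" and w: "set w \<subseteq> Y"
  shows "star q \<phi> w = 0"
proof (cases "d < length w")
  case True
  then show ?thesis using top coset_ann_star[OF q(1) \<phi> Y] w by blast
next
  case False
  have "q L * \<phi> R = 0" if LR: "(L, R) \<in> set (cops w)" for L R
  proof (cases "L = []")
    case False
    then have "0 < length L" by simp
    then have "length R \<noteq> d" using cops_length[OF LR] \<open>\<not> d < length w\<close> by linarith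
    then show ?thesis using \<phi>_supp[of R] by auto
  qed (simp add: q)
  then show ?thesis unfolding star_def by (intro copsum_zero)
qed

text \<open>The radical of the form \<open>(a, g) \<mapsto> \<phi> (a g)\<close> is stable under the operators \<open>a \<mapsto> q * a\<close>.\<close>

lemma radical_stable:
  assumes a: "a \<in> word_space Y" "\<And>w. w \<in> supp a \<Longrightarrow> sigma_w w = \<kappa>"
    and rad: "\<And>g. set g \<subseteq> Y \<Longrightarrow> pair (\<lambda>w. \<phi> (w @ g)) a = 0"
    and \<kappa>: "index_perm n \<kappa>"
  shows "coset_ann n X (letters n) q \<Longrightarrow> set g \<subseteq> Y \<Longrightarrow>
    pair (copsum (\<lambda>L R. q L * \<phi> (R @ g))) a = 0"
proof (induction "length g" arbitrary: q g rule: less_induct)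
  case (less g q)
  \<comment> \<open>Removing the value at the empty word meets the condition of
    \<open>star_top_eq_0\<close>; the removed part is handled by \<open>rad\<close>.\<close>
  define q' where "q' c = (if c \<noteq> [] then q c else 0)" for c
  have q': "coset_ann n X (letters n) q'"
    using coset_ann_restrict[OF less.prems(1), of "\<lambda>k _. k \<noteq> 0"]
    by (simp add: q'_def[abs_def])
  have words: "set w \<subseteq> Y" if "w \<in> supp a" for w using a that by (simp add: word_space_def)
  \<comment> \<open>As \<open>star q' \<phi>\<close> vanishes on \<open>w @ g\<close>,
    \<open>star_append\<close> expresses the contribution of \<open>q'\<close> through right factors
    shorter than \<open>g\<close>.\<close>
  have eq: "copsum (\<lambda>L R. q L * \<phi> (R @ g)) w = q [] * \<phi> (w @ g)
     - copsum (\<lambda>L' R'. if L' = [] then 0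
         else copsum (\<lambda>L R. braid \<kappa> L' q' L * \<phi> (R @ R')) w) g" if "w \<in> supp a" for w
  proof -
    have "copsum (\<lambda>L R. q L * \<phi> (R @ g)) w = q [] * \<phi> (w @ g) + copsum (\<lambda>L R. q' L * \<phi> (R @ g)) w"
      by (subst copsum_split_left_Nil)
         (auto simp: q'_def intro!: copsum_cong)
    moreover have "star q' \<phi> (w @ g) = 0"
      using words[OF that] less.prems(2) by (intro star_top_eq_0 q') (auto simp: q'_def)
    ultimately show ?thesis unfolding star_append a(2)[OF that] by linarith
  qed
  have "pair (copsum (\<lambda>L R. q L * \<phi> (R @ g))) a = q [] * pair (\<lambda>w. \<phi> (w @ g)) a
     - pair (\<lambda>w. copsum (\<lambda>L' R'. if L' = [] then 0
         else copsum (\<lambda>L R. braid \<kappa> L' q' L * \<phi> (R @ R')) w) g) a"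
    unfolding pair_def by (simp add: eq algebra_simps sum_subtractf sum_distrib_left)
  also have "pair (\<lambda>w. copsum (\<lambda>L' R'. if L' = [] then 0
         else copsum (\<lambda>L R. braid \<kappa> L' q' L * \<phi> (R @ R')) w) g) a = 0"
    unfolding pair_copsum
  proof (rule copsum_zero)
    fix L' R' assume LR: "(L', R') \<in> set (cops g)"
    show "pair (\<lambda>w. if L' = [] then 0 else copsum (\<lambda>L R. braid \<kappa> L' q' L * \<phi> (R @ R')) w) a = 0"
    proof (cases "L' = []")
      case True then show ?thesis by (simp add: pair_def)
    next
      case False
      have "set L' \<subseteq> letters n" using cops_left[OF LR] less.prems(2) Y by blast
      moreover have "length R' < length g" using cops_length[OF LR] False by (cases L') auto
      moreover have "set R' \<subseteq> Y" using cops_right[OF LR] less.prems(2) by blast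
      ultimately show ?thesis
        using less.hyps[OF _ coset_ann_braid[OF q' _ \<kappa> X], of R' L'] False by simp
    qed
  qed
  finally show ?case using rad[OF less.prems(2)] by simp
qed

text \<open>In \<open>radical_stable\<close> take \<open>w0\<close> for \<open>g\<close>: since
  \<phi> lives in degree \<open>d\<close>, only the empty right factor survives and
  \<open>pair q a * \<phi> w0\<close> is zero. Thus \<open>a\<close> vanishes in C, hence in A by
  \<open>coset_ann_extension\<close>.\<close>

lemma radical_homogeneous_eq_0:
  assumes a: "a \<in> word_space Y" "\<And>w. w \<in> supp a \<Longrightarrow> sigma_w w = \<kappa>"
    and rad: "\<And>g. set g \<subseteq> Y \<Longrightarrow> pair (\<lambda>w. \<phi> (w @ g)) a = 0"
    and \<chi>: "coset_ann n X Y \<chi>"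
  shows "pair \<chi> a = 0"
proof (cases "supp a = {}")
  case True then show ?thesis by (simp add: pair_def)
next
  case False
  then have \<kappa>: "index_perm n \<kappa>"
    using a Y index_perm_sigma_w[of _ n] unfolding word_space_def by blast
  show ?thesis
  proof (rule coset_ann_extension[OF XY Y a(1) _ \<chi>])
    fix q assume q: "coset_ann n X (letters n) q"
    have "copsum (\<lambda>L R. q L * \<phi> (R @ w0)) w = q w * \<phi> w0" for w
    proof -
      have "copsum (\<lambda>L R. if R = [] then 0 else q L * \<phi> (R @ w0)) w = 0"
      proof (rule copsum_zero)
        fix L R
        show "(if R = [] then 0 else q L * \<phi> (R @ w0)) = 0"
          using \<phi>_supp[of "R @ w0"] length_w0 by (cases R) auto
      qed
      then show ?thesis by (subst copsum_split_right_Nil) simp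
    qed
    then have "pair (copsum (\<lambda>L R. q L * \<phi> (R @ w0))) a = pair q a * \<phi> w0"
      by (simp add: pair_def sum_distrib_right mult.assoc)
    then show "pair q a = 0" using radical_stable[OF a rad \<kappa> q w0(1)] w0(2) by simp
  qed
qed

text \<open>For each \<open>g\<close>, \<phi> sees only the component of \<open>a\<close> whose
  S_n-degree times that of \<open>g\<close> equals the degree of \<open>w0\<close>. So every
  S_n-homogeneous component of \<open>a\<close> lies in the radical.\<close>

lemma radical_eq_0:
  assumes a: "a \<in> word_space Y"
    and rad: "\<And>g. set g \<subseteq> Y \<Longrightarrow> pair (\<lambda>w. \<phi> (w @ g)) a = 0"
    and \<chi>: "coset_ann n X Y \<chi>"
  shows "pair \<chi> a = 0"
proof -
  define A where "A \<kappa> = (\<lambda>w. if sigma_w w = \<kappa> then a w else 0)" for \<kappa>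
  have fin: "finite (supp a)" using a by (rule word_space_finite)
  have suppA: "supp (A \<kappa>) = {w\<in>supp a. sigma_w w = \<kappa>}" for \<kappa> by (auto simp: A_def supp_def)
  have pairA: "pair \<psi> (A \<kappa>) = pair (\<lambda>w. if sigma_w w = \<kappa> then \<psi> w else 0) a" for \<psi> \<kappa>
  proof -
    have "supp (A \<kappa>) \<subseteq> supp a" by (auto simp: suppA)
    from pair_superset[OF fin this] show ?thesis
      unfolding pair_def by (auto simp: A_def intro!: sum.cong)
  qed
  have A0: "pair \<chi> (A \<kappa>) = 0" for \<kappa>
  proof (rule radical_homogeneous_eq_0[OF _ _ _ \<chi>])
    show "A \<kappa> \<in> word_space Y" using a by (auto simp: word_space_def suppA)
    show "sigma_w w = \<kappa>" if "w \<in> supp (A \<kappa>)" for w using that by (simp add: suppA)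
    fix g assume g: "set g \<subseteq> Y"
    show "pair (\<lambda>w. \<phi> (w @ g)) (A \<kappa>) = 0"
    proof (cases "\<kappa> \<circ> sigma_w g = sigma_w w0")
      case True
      have "sigma_w w = \<kappa>" if "\<phi> (w @ g) \<noteq> 0" for w
      proof -
        have "sigma_w w \<circ> sigma_w g = \<kappa> \<circ> sigma_w g"
          using \<phi>_supp[OF that] True by (simp add: sigma_w_append del: comp_apply)
        then show ?thesis using surj_sigma_w[of g] by (metis surj_fun_eq)
      qed
      then have "pair (\<lambda>w. \<phi> (w @ g)) (A \<kappa>) = pair (\<lambda>w. \<phi> (w @ g)) a"
        unfolding pairA by (intro pair_cong) auto
      then show ?thesis using rad[OF g] by simp
    next
      case False
      have "\<phi> (w @ g) = 0" if "sigma_w w = \<kappa>" for w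
        using \<phi>_supp[of "w @ g"] False that by (auto simp: sigma_w_append simp del: comp_apply)
      then show ?thesis unfolding pairA by (intro pair_eq_0) auto
    qed
  qed
  have "pair \<chi> a = (\<Sum>\<kappa>\<in>sigma_w ` supp a. pair \<chi> (A \<kappa>))"
    unfolding pairA unfolding pair_def
    by (subst sum.swap) (use fin in \<open>auto simp: if_distrib sum.delta cong: if_cong intro!: sum.cong\<close>)
  then show ?thesis by (simp add: A0)
qed

text \<open>For nonempty \<open>g\<close> the product \<open>w0 @ g\<close> has degree above
  \<open>d\<close>, so \<open>star_append\<close> writes (q * w0) g as minus a sum of terms (q' *
  w0) g' with shorter g', to which induction applies.\<close>

lemma orbit_right_stable:
  "coset_ann n X (letters n) q \<Longrightarrow> set g \<subseteq> Y \<Longrightarrow>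
   \<exists>q'. coset_ann n X (letters n) q' \<and>
     (\<forall>\<chi>. coset_ann n X Y \<chi> \<longrightarrow> copsum (\<lambda>L R. q L * \<chi> (R @ g)) w0 = star q' \<chi> w0)"
proof (induction "length g" arbitrary: q g rule: less_induct)
  case (less g q)
  show ?case
  proof (cases "g = []")
    case True
    then show ?thesis using less.prems by (auto simp: star_def)
  next
    case False
    let ?P = "\<lambda>L' R' q'. coset_ann n X (letters n) q' \<and>
      (\<forall>\<chi>. coset_ann n X Y \<chi> \<longrightarrow>
        copsum (\<lambda>L R. braid (sigma_w w0) L' q L * \<chi> (R @ R')) w0 = star q' \<chi> w0)"
    have "\<exists>q'. ?P L' R' q'" if LR: "(L', R') \<in> set (cops g)" and "L' \<noteq> []" for L' R'
    proof (rule less.hyps)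
      show "length R' < length g" using cops_length[OF LR] that(2) by (cases L') auto
      show "set R' \<subseteq> Y" using cops_right[OF LR] less.prems(2) by blast
      have "set L' \<subseteq> letters n" using cops_left[OF LR] less.prems(2) Y by blast
      then show "coset_ann n X (letters n) (braid (sigma_w w0) L' q)"
        using w0(1) Y less.prems(1) X by (intro coset_ann_braid index_perm_sigma_w) auto
    qed
    then obtain f where f: "\<And>L' R'. (L', R') \<in> set (cops g) \<Longrightarrow> L' \<noteq> [] \<Longrightarrow> ?P L' R' (f L' R')"
      by metis
    \<comment> \<open>The term with empty \<open>L'\<close> is the one being solved for, hence the
      value zero here and the sign in \<open>q'\<close>.\<close>
    define F where "F L' R' = (if L' = [] then (\<lambda>_. 0) else f L' R')" for L' R'
    define q' where "q' c = - copsum (\<lambda>L' R'. F L' R' c) g" for c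
    have "coset_ann n X (letters n) q'"
      unfolding q'_def
      by (intro coset_ann_uminus coset_ann_copsum) (use f in \<open>auto simp: F_def coset_ann_zero\<close>)
    moreover have "copsum (\<lambda>L R. q L * \<chi> (R @ g)) w0 = star q' \<chi> w0" if \<chi>: "coset_ann n X Y \<chi>" for \<chi>
    proof -
      have "star q \<chi> (w0 @ g) = 0"
        using top[OF coset_ann_star[OF less.prems(1) \<chi> Y], of "w0 @ g"] False w0(1) less.prems(2)
        by (simp add: length_w0)
      then have "copsum (\<lambda>L R. q L * \<chi> (R @ g)) w0 = - copsum (\<lambda>L' R'. if L' = [] then 0
         else copsum (\<lambda>L R. braid (sigma_w w0) L' q L * \<chi> (R @ R')) w0) g"
        unfolding star_append by simp
      also have "copsum (\<lambda>L' R'. if L' = [] then 0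
         else copsum (\<lambda>L R. braid (sigma_w w0) L' q L * \<chi> (R @ R')) w0) g
         = copsum (\<lambda>L' R'. star (F L' R') \<chi> w0) g"
        by (intro copsum_cong) (use f \<chi> in \<open>simp add: F_def star_def copsum_zero\<close>)
      also have "- \<dots> = star q' \<chi> w0"
        unfolding star_def q'_def by (subst copsum_swap) (simp add: copsum_mult_right copsum_minus)
      finally show ?thesis .
    qed
    ultimately show ?thesis by blast
  qed
qed

text \<open>The class of \<open>w0\<close> is nonzero in A, as \<phi> shows, and stays nonzero in C.
  A functional on C detecting it is cut down to degree \<open>d\<close> and normalised.\<close>

lemma top_separated:
  obtains q where "coset_ann n X (letters n) q" "q w0 = 1" "\<And>w. length w \<noteq> d \<Longrightarrow> q w = 0"
proof -
  have "\<exists>q. coset_ann n X (letters n) q \<and> q w0 \<noteq> 0"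
    using coset_ann_extension[OF XY Y word_space_wrd[OF w0(1)] _ \<phi>] w0(2) by auto
  then obtain q where q: "coset_ann n X (letters n) q" "q w0 \<noteq> 0" by blast
  show ?thesis
  proof
    show "coset_ann n X (letters n) (\<lambda>w. 1 / q w0 * (if length w = d then q w else 0))"
      using coset_ann_restrict[OF q(1), of "\<lambda>k _. k = d"] by (rule coset_ann_scale)
  qed (use q length_w0 in auto)
qed

text \<open>The functional of \<open>top_separated\<close> sends \<open>w0\<close> to 1, because
  only the empty right factor leaves \<open>d\<close> letters on the left. By right stability the
  orbit of \<open>w0\<close> then contains every word over Y, and by linearity all of A.\<close>

lemma orbit_spanning:
  assumes a: "a \<in> word_space Y"
  obtains q where "coset_ann n X (letters n) q" "\<And>\<chi>. coset_ann n X Y \<chi> \<Longrightarrow> pair \<chi> a = star q \<chi> w0"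
proof -
  obtain q0 where q0: "coset_ann n X (letters n) q0" "q0 w0 = 1" "\<And>w. length w \<noteq> d \<Longrightarrow> q0 w = 0"
    using top_separated by blast
  have "copsum (\<lambda>L R. q0 L * \<chi> (R @ g)) w0 = \<chi> g" for \<chi> g
  proof -
    have "copsum (\<lambda>L R. if R = [] then 0 else q0 L * \<chi> (R @ g)) w0 = 0"
    proof (rule copsum_zero)
      fix L R assume LR: "(L, R) \<in> set (cops w0)"
      show "(if R = [] then 0 else q0 L * \<chi> (R @ g)) = 0"
        using cops_length[OF LR] length_w0 q0(3)[of L] by (cases R) auto
    qed
    then show ?thesis by (subst copsum_split_right_Nil) (simp add: q0)
  qed
  then have "\<exists>q. coset_ann n X (letters n) q \<and> (\<forall>\<chi>. coset_ann n X Y \<chi> \<longrightarrow> \<chi> g = star q \<chi> w0)"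
    if "set g \<subseteq> Y" for g
    using orbit_right_stable[OF q0(1) that] by simp
  then obtain Q where Q: "\<And>g. set g \<subseteq> Y \<Longrightarrow> coset_ann n X (letters n) (Q g)"
    "\<And>g \<chi>. set g \<subseteq> Y \<Longrightarrow> coset_ann n X Y \<chi> \<Longrightarrow> \<chi> g = star (Q g) \<chi> w0"
    by metis
  have words: "set w \<subseteq> Y" if "w \<in> supp a" for w using a that by (simp add: word_space_def)
  show ?thesis
  proof (rule that[of "\<lambda>c. \<Sum>g\<in>supp a. a g * Q g c"])
    show "coset_ann n X (letters n) (\<lambda>c. \<Sum>g\<in>supp a. a g * Q g c)"
      using Q words by (intro coset_ann_sum coset_ann_scale) auto
    fix \<chi> assume \<chi>: "coset_ann n X Y \<chi>"
    have "pair \<chi> a = (\<Sum>g\<in>supp a. a g * star (Q g) \<chi> w0)"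
      unfolding pair_def using Q(2)[OF words \<chi>] by (intro sum.cong) auto
    then show "pair \<chi> a = star (\<lambda>c. \<Sum>g\<in>supp a. a g * Q g c) \<chi> w0"
      by (simp add: star_def sum_distrib_right copsum_sum copsum_mult_left mult.assoc)
  qed
qed

end

subsection \<open>Translation to elements of the algebra\<close>

text \<open>Acting by \<psi> is adjoint to convolution with \<psi>; this turns congruences involving
  \<open>costar\<close> into identities between functionals.\<close>

lemma pair_costar:
  assumes f: "finite (supp f)"
  shows "finite (supp (costar \<psi> f))" and "pair \<chi> (costar \<psi> f) = pair (star \<psi> \<chi>) f"
    and "f \<in> FA n \<Longrightarrow> costar \<psi> f \<in> FA n"
proof -
  define V where "V = (\<Union>w\<in>supp f. snd ` set (cops w))"
  have V: "finite V" using f by (simp add: V_def)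
  have eq: "costar \<psi> f v = (\<Sum>w\<in>supp f. f w * copsum (\<lambda>L R. if R = v then \<psi> L else 0) w)" for v
    unfolding costar_def sum_Pow_cop[of "\<lambda>L R. if R = v then \<psi> L else 0" for v] ..
  have VI: "R \<in> V" if "w \<in> supp f" "(L, R) \<in> set (cops w)" for w L R
    unfolding V_def using that by (metis UN_I image_eqI snd_conv)
  have sub: "supp (costar \<psi> f) \<subseteq> V"
  proof (rule subsetI, rule ccontr)
    fix v assume v: "v \<in> supp (costar \<psi> f)" "v \<notin> V"
    have "copsum (\<lambda>L R. if R = v then \<psi> L else 0) w = 0" if "w \<in> supp f" for w
      by (rule copsum_zero) (use VI[OF that] v(2) in auto)
    then have "costar \<psi> f v = 0" unfolding eq by simp
    then show False using v(1) by (simp add: supp_def)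
  qed
  show "finite (supp (costar \<psi> f))" using sub V by (rule finite_subset)
  show "costar \<psi> f \<in> FA n" if "f \<in> FA n"
  proof -
    have "set v \<subseteq> letters n" if "v \<in> V" for v
    proof -
      obtain w L where "w \<in> supp f" "(L, v) \<in> set (cops w)" using \<open>v \<in> V\<close> by (auto simp: V_def)
      then show ?thesis using cops_right \<open>f \<in> FA n\<close> unfolding FA_def by blast
    qed
    then show ?thesis using sub finite_subset[OF sub V] by (auto simp: FA_def)
  qed
  have "pair \<chi> (costar \<psi> f) = (\<Sum>v\<in>V. (\<Sum>w\<in>supp f. f w * copsum (\<lambda>L R. if R = v then \<psi> L else 0) w) * \<chi> v)"
    using pair_superset[OF V sub] by (simp add: eq)
  also have "\<dots> = (\<Sum>w\<in>supp f. f w * (\<Sum>v\<in>V. copsum (\<lambda>L R. if R = v then \<psi> L * \<chi> v else 0) w))"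
  proof -
    have "copsum (\<lambda>L R. if R = v then \<psi> L * \<chi> v else 0) w = copsum (\<lambda>L R. if R = v then \<psi> L else 0) w * \<chi> v" for v w
      unfolding copsum_mult_right[symmetric] by (intro copsum_cong) simp
    then show ?thesis
      by (simp add: sum_distrib_right sum_distrib_left mult.assoc sum.swap[of _ V])
  qed
  also have "\<dots> = pair (star \<psi> \<chi>) f"
    unfolding pair_def star_def copsum_sum[symmetric]
  proof (intro sum.cong arg_cong2[where f = "(*)"] copsum_cong refl)
    fix w L R assume "w \<in> supp f" "(L, R) \<in> set (cops w)"
    then have "R \<in> V" by (rule VI)
    then show "(\<Sum>v\<in>V. if R = v then \<psi> L * \<chi> v else 0) = \<psi> L * \<chi> R" using V by simp
  qed
  finally show "pair \<chi> (costar \<psi> f) = pair (star \<psi> \<chi>) f" .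
qed

lemma pair_ext:
  assumes "finite (supp f)" "finite (supp g)" "\<And>\<psi>. pair \<psi> f = pair \<psi> g"
  shows "f = g"
proof
  fix w
  have "pair (\<lambda>v. if v = w then 1 else 0) h = h w" if "finite (supp h)" for h
  proof -
    have "pair (\<lambda>v. if v = w then 1 else 0) h = (\<Sum>v\<in>supp h. if v = w then h w else 0)"
      unfolding pair_def by (rule sum.cong) auto
    then show ?thesis using that by (auto simp: supp_def)
  qed
  then show "f w = g w" using assms by metis
qed

section \<open>Multiplication modulo the ideal\<close>

lemma fmul_wrd: "fmul (wrd u) (wrd v) = wrd (u @ v)"
  by (rule pair_ext) (simp_all add: finite_supp_fmul pair_fmul)

lemma fmul_assoc:
  assumes "finite (supp f)" "finite (supp g)" "finite (supp h)"
  shows "fmul (fmul f g) h = fmul f (fmul g h)"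
  using assms by (intro pair_ext) (simp_all add: finite_supp_fmul pair_fmul)

lemma fmul_Nil_left: "finite (supp f) \<Longrightarrow> fmul (wrd []) f = f"
  by (rule pair_ext) (simp_all add: finite_supp_fmul pair_fmul)

lemma fmul_plus_left: "fmul (f + g) h = fmul f h + fmul g h"
  by (simp add: fmul_def fun_eq_iff fun_ops algebra_simps sum.distrib)

lemma fmul_minus_left: "fmul (f - g) h = fmul f h - fmul g h"
  by (simp add: fmul_def fun_eq_iff fun_ops algebra_simps sum_subtractf)

lemma fmul_minus_right: "fmul f (g - h) = fmul f g - fmul f h"
  by (simp add: fmul_def fun_eq_iff fun_ops algebra_simps sum_subtractf)

lemma fmul_fsmult_left: "fmul (fsmult c f) g = fsmult c (fmul f g)"
  by (simp add: fmul_def fsmult_def fun_eq_iff sum_distrib_left mult.assoc)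

lemma fmul_fsmult_right: "fmul f (fsmult c g) = fsmult c (fmul f g)"
  by (simp add: fmul_def fsmult_def fun_eq_iff sum_distrib_left mult.left_commute)

lemma fmul_zero_left [simp]: "fmul 0 g = 0"
  by (simp add: fmul_def fun_eq_iff fun_ops)

lemma fmul_sum_left: "fmul (\<Sum>i\<in>A. f i) g = (\<Sum>i\<in>A. fmul (f i) g)"
  by (induction A rule: infinite_finite_induct) (simp_all add: fmul_plus_left)

lemma fmul_sum_right: "fmul f (\<Sum>i\<in>A. g i) = (\<Sum>i\<in>A. fmul f (g i))"
  by (simp add: fmul_def fun_eq_iff fa_sum_apply sum_distrib_left sum.swap[of _ A])

lemma Ideal_fmul_left:
  assumes r: "r \<in> Ideal n" and f: "f \<in> FA n"
  shows "fmul f r \<in> Ideal n"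
proof -
  have "f = (\<Sum>x\<in>supp f. fsmult (f x) (wrd x))" using f by (intro fa_expand) (simp add: FA_def)
  then have "fmul f r = (\<Sum>x\<in>supp f. fsmult (f x) (fmul (wrd x) r))"
    by (metis (no_types, lifting) fmul_fsmult_left fmul_sum_left sum.cong)
  then show ?thesis
    using r f by (auto simp: FA_def intro!: fa.subspace_sum[OF subspace_Ideal] Ideal.smult Ideal.lmul Ideal.rmul)
qed

lemma Ideal_fmul_right:
  assumes r: "r \<in> Ideal n" and f: "f \<in> FA n"
  shows "fmul r f \<in> Ideal n"
proof -
  have "f = (\<Sum>x\<in>supp f. fsmult (f x) (wrd x))" using f by (intro fa_expand) (simp add: FA_def)
  then have "fmul r f = (\<Sum>x\<in>supp f. fsmult (f x) (fmul r (wrd x)))"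
    by (metis (no_types, lifting) fmul_fsmult_right fmul_sum_right sum.cong)
  then show ?thesis
    using r f by (auto simp: FA_def intro!: fa.subspace_sum[OF subspace_Ideal] Ideal.smult Ideal.lmul Ideal.rmul)
qed

lemma FA_finite: "f \<in> FA n \<Longrightarrow> finite (supp f)"
  by (simp add: FA_def)

lemma subspace_FA: "fa.subspace (FA n)"
  unfolding FA_eq by (rule subspace_word_space)

lemma FA_fmul: "f \<in> FA n \<Longrightarrow> g \<in> FA n \<Longrightarrow> fmul f g \<in> FA n"
  unfolding FA_eq by (rule word_space_fmul)

text \<open>The common form of \<open>EG\<close>, \<open>EGplus\<close> and \<open>homog\<close>, so
  that closure under sums, scalars and products is proved once.\<close>

definition words_mod :: "nat \<Rightarrow> (word \<Rightarrow> bool) \<Rightarrow> fa set" where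
  "words_mod n P = {f \<in> FA n. \<exists>g \<in> FA n. eqv n f g \<and> (\<forall>w\<in>supp g. P w)}"

lemma EG_eq: "EG n G = words_mod n (\<lambda>w. set w \<subseteq> gletters G)"
  by (simp add: EG_def words_mod_def)

lemma EGplus_eq: "EGplus n G = words_mod n (\<lambda>w. set w \<subseteq> gletters G \<and> w \<noteq> [])"
  by (simp add: EGplus_def words_mod_def)

lemma homog_iff: "homog n d f \<longleftrightarrow> f \<in> words_mod n (\<lambda>w. length w = d)"
  by (auto simp: homog_def words_mod_def)

lemma words_mod_FA: "f \<in> words_mod n P \<Longrightarrow> f \<in> FA n"
  by (simp add: words_mod_def)

lemma words_mod_finite: "f \<in> words_mod n P \<Longrightarrow> finite (supp f)"
  by (simp add: words_mod_def FA_def)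

lemma words_mod_mono: "f \<in> words_mod n P \<Longrightarrow> (\<And>w. P w \<Longrightarrow> Q w) \<Longrightarrow> f \<in> words_mod n Q"
  by (auto simp: words_mod_def)

lemma words_modI:
  "f \<in> FA n \<Longrightarrow> g \<in> FA n \<Longrightarrow> f - g \<in> Ideal n \<Longrightarrow> (\<And>w. w \<in> supp g \<Longrightarrow> P w) \<Longrightarrow> f \<in> words_mod n P"
  by (auto simp: words_mod_def eqv_def fa_eqs)

lemma words_modE:
  assumes "f \<in> words_mod n P"
  obtains g where "g \<in> FA n" "f - g \<in> Ideal n" "\<And>w. w \<in> supp g \<Longrightarrow> P w"
  using assms by (auto simp: words_mod_def eqv_def fa_eqs)

lemma zero_Ideal: "0 \<in> Ideal n"
  using Ideal.zero by (simp add: fa_eqs)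

lemma words_mod_wrd: "set w \<subseteq> letters n \<Longrightarrow> P w \<Longrightarrow> wrd w \<in> words_mod n P"
  by (rule words_modI[of _ _ "wrd w"]) (auto simp: FA_def zero_Ideal)

lemma subspace_words_mod: "fa.subspace (words_mod n P)"
proof (rule fa.subspaceI)
  show "0 \<in> words_mod n P"
    by (rule words_modI[of _ _ 0]) (simp_all add: zero_Ideal FA_def)
  show "x + y \<in> words_mod n P" if xy: "x \<in> words_mod n P" "y \<in> words_mod n P" for x y
  proof -
    obtain g where g: "g \<in> FA n" "x - g \<in> Ideal n" "\<And>w. w \<in> supp g \<Longrightarrow> P w"
      using xy(1) by (rule words_modE) blast
    obtain h where h: "h \<in> FA n" "y - h \<in> Ideal n" "\<And>w. w \<in> supp h \<Longrightarrow> P w"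
      using xy(2) by (rule words_modE) blast
    show ?thesis
    proof (rule words_modI)
      show "x + y \<in> FA n" "g + h \<in> FA n"
        using xy[THEN words_mod_FA] g h by (auto intro: fa.subspace_add[OF subspace_FA])
      have "x + y - (g + h) = (x - g) + (y - h)" by simp
      then show "x + y - (g + h) \<in> Ideal n"
        using fa.subspace_add[OF subspace_Ideal g(2) h(2)] by (simp only:)
      show "P w" if "w \<in> supp (g + h)" for w
        using that supp_plus[of g h] g(3) h(3) by blast
    qed
  qed
  show "fsmult c x \<in> words_mod n P" if x: "x \<in> words_mod n P" for c x
  proof -
    obtain g where g: "g \<in> FA n" "x - g \<in> Ideal n" "\<And>w. w \<in> supp g \<Longrightarrow> P w"
      using x by (rule words_modE) blast
    show ?thesis
    proof (rule words_modI)
      show "fsmult c x \<in> FA n" "fsmult c g \<in> FA n"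
        using words_mod_FA[OF x] g by (auto intro: fa.subspace_scale[OF subspace_FA])
      show "fsmult c x - fsmult c g \<in> Ideal n"
        using fa.subspace_scale[OF subspace_Ideal g(2), of c] by (simp add: fa.scale_right_diff_distrib)
      show "P w" if "w \<in> supp (fsmult c g)" for w
        using that supp_fsmult[of c g] g(3) by blast
    qed
  qed
qed

lemma words_mod_fmul:
  assumes f: "f \<in> words_mod n P" and g: "g \<in> words_mod n Q"
    and PQ: "\<And>x y. P x \<Longrightarrow> Q y \<Longrightarrow> R (x @ y)"
  shows "fmul f g \<in> words_mod n R"
proof -
  obtain f' where f': "f' \<in> FA n" "f - f' \<in> Ideal n" "\<And>w. w \<in> supp f' \<Longrightarrow> P w"
    using f by (rule words_modE) blast
  obtain g' where g': "g' \<in> FA n" "g - g' \<in> Ideal n" "\<And>w. w \<in> supp g' \<Longrightarrow> Q w"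
    using g by (rule words_modE) blast
  show ?thesis
  proof (rule words_modI)
    show "fmul f g \<in> FA n" "fmul f' g' \<in> FA n"
      using words_mod_FA[OF f] words_mod_FA[OF g] f' g' by (auto intro: FA_fmul)
    have "fmul f g - fmul f' g' = fmul (f - f') g + fmul f' (g - g')"
      by (simp add: fmul_minus_left fmul_minus_right)
    then show "fmul f g - fmul f' g' \<in> Ideal n"
      using Ideal_fmul_right[OF f'(2) words_mod_FA[OF g]] Ideal_fmul_left[OF g'(2) f'(1)]
      by (simp add: fa.subspace_add[OF subspace_Ideal])
    show "R w" if "w \<in> supp (fmul f' g')" for w
      using that supp_fmul[of f' g'] f'(3) g'(3) PQ by blast
  qed
qed

lemma pair_eqv:
  assumes "f \<in> FA n" "g \<in> FA n" "f - g \<in> Ideal n" "ann_rels n \<psi>"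
  shows "pair \<psi> f = pair \<psi> g"
  using pair_Ideal[OF assms(3,4)] assms(1,2) by (simp add: pair_minus FA_finite)

lemma words_mod_pair_cong:
  assumes f: "f \<in> words_mod n P" and \<psi>: "ann_rels n \<psi>" and \<chi>: "ann_rels n \<chi>"
    and eq: "\<And>w. set w \<subseteq> letters n \<Longrightarrow> P w \<Longrightarrow> \<psi> w = \<chi> w"
  shows "pair \<psi> f = pair \<chi> f"
proof -
  obtain g where g: "g \<in> FA n" "f - g \<in> Ideal n" "\<And>w. w \<in> supp g \<Longrightarrow> P w"
    using f by (rule words_modE) blast
  have "pair \<psi> g = pair \<chi> g" using g eq by (intro pair_cong) (auto simp: FA_def)
  then show ?thesis using pair_eqv[OF words_mod_FA[OF f] g(1,2)] \<psi> \<chi> by simp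
qed

lemma ann_rels_zero: "ann_rels n (\<lambda>_. 0)"
  using ann_rels_scale[OF ann_rels_counit, of n 0] by simp

lemma words_mod_pair_eq_0:
  assumes "f \<in> words_mod n P" "ann_rels n \<psi>" "\<And>w. set w \<subseteq> letters n \<Longrightarrow> P w \<Longrightarrow> \<psi> w = 0"
  shows "pair \<psi> f = 0"
  using words_mod_pair_cong[OF assms(1,2) ann_rels_zero] assms(3) by (simp add: pair_def)

lemma ann_rels_pair_right:
  assumes "ann_rels n \<psi>" "f \<in> FA n"
  shows "ann_rels n (\<lambda>x. pair (\<lambda>y. \<psi> (x @ y)) f)"
  unfolding pair_def
  using assms ann_rels_shift[OF assms(1), of "[]"]
  by (intro ann_rels_sum ann_rels_scale) (auto simp: FA_def)

text \<open>Nonempty words in the letters of H begin in H, and \<psi> kills every such word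
  continued by letters of E_n. This is the vanishing demanded of the functional in claim
  (b).\<close>

lemma pair_prodspace:
  assumes f: "f \<in> prodspace n (EGplus n H) (FA n)" and \<psi>: "coset_ann n (gletters H) (letters n) \<psi>"
  shows "pair \<psi> f = 0"
proof -
  have prod: "pair \<psi> (fmul a b) = 0" if a: "a \<in> EGplus n H" and b: "b \<in> FA n" for a b
  proof -
    have "pair (\<lambda>x. pair (\<lambda>y. \<psi> (x @ y)) b) a = 0"
    proof (rule words_mod_pair_eq_0[OF a[unfolded EGplus_eq] ann_rels_pair_right[OF coset_ann_rels[OF \<psi>] b]])
      fix w assume w: "set w \<subseteq> letters n" "set w \<subseteq> gletters H \<and> w \<noteq> []"
      show "pair (\<lambda>y. \<psi> (w @ y)) b = 0"
      proof (rule pair_eq_0)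
        fix y assume "y \<in> supp b"
        then have "set y \<subseteq> letters n" using b by (simp add: FA_def)
        then show "\<psi> (w @ y) = 0"
          using w coset_annD[OF \<psi>, of "hd w" "tl w @ y"] by (cases w) auto
      qed
    qed
    then show ?thesis using a b by (simp add: pair_fmul EGplus_eq words_mod_finite FA_finite)
  qed
  obtain g where g: "g \<in> spn {fmul a b | a b. a \<in> EGplus n H \<and> b \<in> FA n}" "eqv n f g" and fFA: "f \<in> FA n"
    using f by (auto simp: prodspace_def)
  from g(1) have "g \<in> FA n \<and> pair \<psi> g = 0"
  proof induction
    case (base a)
    then show ?case using prod by (auto intro!: FA_fmul simp: EGplus_eq words_mod_FA)
  next
    case zero
    then show ?case by (simp add: fa_eqs FA_def)
  next
    case (add a b)
    then show ?case 
      by (simp add: fa_eqs pair_plus FA_finite[of _ n] fa.subspace_add[OF subspace_FA])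
  next
    case (smult a c)
    then show ?case 
      by (simp add: pair_fsmult FA_finite[of _ n] fa.subspace_scale[OF subspace_FA])
  qed
  then show ?thesis
    using pair_eqv[OF fFA, of g] g(2) coset_ann_rels[OF \<psi>] by (simp add: eqv_def fa_eqs)
qed

section \<open>Testing congruences by functionals\<close>

text \<open>For X inside Y this is the preimage of E_X^+ E_Y among combinations of words; its
  annihilator is \<open>coset_ann n X Y\<close>.\<close>

definition coset_ideal :: "nat \<Rightarrow> letter set \<Rightarrow> letter set \<Rightarrow> fa set" where
  "coset_ideal n X Y = fa.span (Ideal n \<union> {wrd (t # w) | t w. t \<in> X \<and> set w \<subseteq> Y})"

lemma coset_ideal_if_annihilated:
  assumes XY: "X \<subseteq> letters n" "Y \<subseteq> letters n" and f: "f \<in> FA n"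
    and ann: "\<And>\<chi>. coset_ann n X Y \<chi> \<Longrightarrow> pair \<chi> f = 0"
  shows "f \<in> coset_ideal n X Y"
proof -
  let ?W = "{wrd (t # w) | t w. t \<in> X \<and> set w \<subseteq> Y}"
  have "?W \<subseteq> FA n"
  proof clarify
    fix t w assume "t \<in> X" "set w \<subseteq> Y"
    then have "set (t # w) \<subseteq> letters n" using XY unfolding list.set by blast
    then show "wrd (t # w) \<in> FA n" by (simp add: FA_def)
  qed
  then have FA: "coset_ideal n X Y \<subseteq> FA n"
    unfolding coset_ideal_def using Ideal_FA
    by (intro fa.span_minimal[OF _ subspace_FA]) (auto simp: FA_eq)
  show ?thesis
  proof (rule double_annihilator)
    show "fa.subspace (coset_ideal n X Y)" by (simp add: coset_ideal_def)
    show "finite (supp f)" using f by (rule FA_finite)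
    show "finite (supp u)" if "u \<in> coset_ideal n X Y" for u using that FA FA_finite by blast
    fix \<psi> assume \<psi>: "\<And>u. u \<in> coset_ideal n X Y \<Longrightarrow> pair \<psi> u = 0"
    have *: "pair \<psi> u = 0" if "u \<in> Ideal n \<union> ?W" for u
      using \<psi> fa.span_base[OF that] by (simp add: coset_ideal_def)
    have "ann_rels n \<psi>" by (rule ann_rels_if_pair_Ideal) (use * in blast)
    moreover have "\<psi> (t # w) = 0" if "t \<in> X" "set w \<subseteq> Y" for t w
    proof -
      have "wrd (t # w) \<in> Ideal n \<union> ?W" using that by blast
      from *[OF this] show ?thesis by simp
    qed
    ultimately show "pair \<psi> f = 0" by (intro ann) (simp add: coset_ann_def)
  qed
qed

lemma coset_ideal_prodspace:
  assumes HG: "gletters H \<subseteq> letters n" "gletters G \<subseteq> letters n"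
  shows "coset_ideal n (gletters H) (gletters G) \<subseteq> prodspace n (EGplus n H) (EG n G)"
  unfolding coset_ideal_def
proof (rule fa.span_minimal)
  let ?S = "{fmul a b | a b. a \<in> EGplus n H \<and> b \<in> EG n G}"
  show "Ideal n \<union> {wrd (t # w) | t w. t \<in> gletters H \<and> set w \<subseteq> gletters G}
      \<subseteq> prodspace n (EGplus n H) (EG n G)"
  proof
    fix f assume "f \<in> Ideal n \<union> {wrd (t # w) | t w. t \<in> gletters H \<and> set w \<subseteq> gletters G}"
    then consider "f \<in> Ideal n" | t w where "f = wrd (t # w)" "t \<in> gletters H" "set w \<subseteq> gletters G"
      by blast
    then show "f \<in> prodspace n (EGplus n H) (EG n G)"
    proof cases
      case 1
      then show ?thesis using Ideal_FA[OF 1] spn.zero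
        by (auto simp: prodspace_def eqv_def fa_eqs FA_eq intro!: bexI[of _ 0])
    next
      case 2
      have "wrd [t] \<in> EGplus n H" "wrd w \<in> EG n G"
        using 2 HG unfolding EGplus_eq EG_eq by (auto intro!: words_mod_wrd)
      then have "fmul (wrd [t]) (wrd w) \<in> spn ?S" by (intro spn.base) blast
      moreover have "f \<in> FA n" using 2 HG by (auto simp: FA_def)
      ultimately show ?thesis
        using 2(1) by (auto simp: prodspace_def eqv_def fa_eqs zero_Ideal fmul_wrd intro!: bexI[of _ f])
    qed
  qed
  show "fa.subspace (prodspace n (EGplus n H) (EG n G))"
  proof (rule fa.subspaceI)
    show "0 \<in> prodspace n (EGplus n H) (EG n G)"
      using spn.zero by (auto simp: prodspace_def eqv_def fa_eqs zero_Ideal FA_def intro!: bexI[of _ 0])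
    show "x + y \<in> prodspace n (EGplus n H) (EG n G)"
      if "x \<in> prodspace n (EGplus n H) (EG n G)" "y \<in> prodspace n (EGplus n H) (EG n G)" for x y
    proof -
      obtain g h where gh: "x \<in> FA n" "y \<in> FA n" "g \<in> spn ?S" "h \<in> spn ?S" "x - g \<in> Ideal n" "y - h \<in> Ideal n"
        using \<open>x \<in> _\<close> \<open>y \<in> _\<close> by (auto simp: prodspace_def eqv_def fa_eqs)
      have "x + y - (g + h) = (x - g) + (y - h)" by simp
      then have "x + y - (g + h) \<in> Ideal n"
        using fa.subspace_add[OF subspace_Ideal gh(5,6)] by (simp only:)
      then show ?thesis
        using gh spn.add[OF gh(3,4)] fa.subspace_add[OF subspace_FA gh(1,2)]
        by (auto simp: prodspace_def eqv_def fa_eqs)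
    qed
    show "fsmult c x \<in> prodspace n (EGplus n H) (EG n G)"
      if "x \<in> prodspace n (EGplus n H) (EG n G)" for c x
    proof -
      obtain g where g: "x \<in> FA n" "g \<in> spn ?S" "x - g \<in> Ideal n"
        using \<open>x \<in> _\<close> by (auto simp: prodspace_def eqv_def fa_eqs)
      have "fsmult c x - fsmult c g \<in> Ideal n"
        using fa.subspace_scale[OF subspace_Ideal g(3), of c] by (simp add: fa.scale_right_diff_distrib)
      then show ?thesis
        using g spn.smult[OF g(2), of c] fa.subspace_scale[OF subspace_FA g(1)]
        by (auto simp: prodspace_def eqv_def fa_eqs)
    qed
  qed
qed

lemma prodspaceI:
  assumes "gletters H \<subseteq> letters n" "gletters G \<subseteq> letters n" "f \<in> FA n"
    and "\<And>\<chi>. coset_ann n (gletters H) (gletters G) \<chi> \<Longrightarrow> pair \<chi> f = 0"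
  shows "f \<in> prodspace n (EGplus n H) (EG n G)"
  using coset_ideal_if_annihilated[OF assms] coset_ideal_prodspace[OF assms(1,2)] by blast

section \<open>Generating sets and coset representatives\<close>

lemma lcomb_eq: "lcomb F c = (\<Sum>m\<in>F. fmul (c m) m)"
  by (simp add: lcomb_def fun_eq_iff fa_sum_apply)

text \<open>Modulo E_H^+ E_G only the constant parts of the coefficients survive, so generators over
  E_H span A linearly.\<close>

lemma generates_spanning:
  assumes HG: "gletters H \<subseteq> gletters G" "gletters G \<subseteq> letters n"
    and S: "S \<subseteq> EG n G" "generates n H G S"
    and \<chi>: "coset_ann n (gletters H) (gletters G) \<chi>" "\<And>s. s \<in> S \<Longrightarrow> pair \<chi> s = 0"
    and w: "set w \<subseteq> gletters G"
  shows "\<chi> w = 0"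
proof -
  have wE: "wrd w \<in> EG n G" unfolding EG_eq using w HG by (intro words_mod_wrd) auto
  then obtain F c where F: "finite F" "F \<subseteq> S" and c: "\<And>m. m \<in> F \<Longrightarrow> c m \<in> EG n H"
    and eq: "wrd w - lcomb F c \<in> Ideal n"
    using S(2) unfolding generates_def eqv_def fa_eqs by meson
  have fin: "finite (supp (fmul (c m) m))" and FA: "fmul (c m) m \<in> FA n" if "m \<in> F" for m
  proof -
    show "fmul (c m) m \<in> FA n"
      using c[OF that] S(1) F(2) that unfolding EG_eq by (blast intro: FA_fmul words_mod_FA)
    then show "finite (supp (fmul (c m) m))" by (rule FA_finite)
  qed
  have "pair \<chi> (fmul (c m) m) = 0" if m: "m \<in> F" for m
  proof -
    have mE: "m \<in> words_mod n (\<lambda>w. set w \<subseteq> gletters G)" using m F S by (auto simp: EG_eq)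
    have cE: "c m \<in> words_mod n (\<lambda>w. set w \<subseteq> gletters H)" using c[OF m] by (simp add: EG_eq)
    have "pair (\<lambda>x. pair (\<lambda>y. \<chi> (x @ y)) m) (c m) = 0"
    proof (rule words_mod_pair_eq_0[OF cE ann_rels_pair_right[OF coset_ann_rels[OF \<chi>(1)] words_mod_FA[OF mE]]])
      fix x assume x: "set x \<subseteq> letters n" "set x \<subseteq> gletters H"
      show "pair (\<lambda>y. \<chi> (x @ y)) m = 0"
      proof (cases x)
        case Nil
        then show ?thesis using \<chi>(2) m F by auto
      next
        case (Cons t x')
        show ?thesis
        proof (rule words_mod_pair_eq_0[OF mE])
          show "ann_rels n (\<lambda>y. \<chi> (x @ y))"
            using ann_rels_shift[OF coset_ann_rels[OF \<chi>(1)] x(1), of "[]"] by simp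
          show "\<chi> (x @ y) = 0" if "set y \<subseteq> gletters G" for y
            using coset_annD[OF \<chi>(1), of t "x' @ y"] that x HG Cons by auto
        qed
      qed
    qed
    then show ?thesis using mE cE by (simp add: pair_fmul words_mod_finite)
  qed
  then have "pair \<chi> (lcomb F c) = 0" unfolding lcomb_eq using fin by (simp add: pair_sum)
  moreover have "lcomb F c \<in> FA n" unfolding lcomb_eq using FA by (intro fa.subspace_sum[OF subspace_FA])
  ultimately show ?thesis
    using pair_eqv[OF _ _ eq coset_ann_rels[OF \<chi>(1)]] wE by (simp add: EG_eq words_mod_FA)
qed

text \<open>Finitely many generators have representatives of bounded length. A coset functional cut
  down to longer words kills all of them, hence is zero on words over G.\<close>

lemma generates_bounded:
  assumes HG: "gletters H \<subseteq> gletters G" "gletters G \<subseteq> letters n" and fg: "fin_gen n H G"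
  obtains D where "\<And>\<chi> w. coset_ann n (gletters H) (gletters G) \<chi> \<Longrightarrow> set w \<subseteq> gletters G \<Longrightarrow> D < length w \<Longrightarrow> \<chi> w = 0"
proof -
  obtain S where S: "finite S" "S \<subseteq> EG n G" "generates n H G S"
    using fg by (auto simp: fin_gen_def)
  have "\<forall>s\<in>S. \<exists>a. a \<in> FA n \<and> s - a \<in> Ideal n"
    using S(2) unfolding EG_eq by (blast elim: words_modE)
  then obtain a where a: "\<And>s. s \<in> S \<Longrightarrow> a s \<in> FA n \<and> s - a s \<in> Ideal n" by metis
  define D where "D = Max (insert 0 (length ` (\<Union>s\<in>S. supp (a s))))"
  have fin: "finite (\<Union>s\<in>S. supp (a s))" using S a by (auto simp: FA_def)
  have D: "length w \<le> D" if "s \<in> S" "w \<in> supp (a s)" for s w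
    unfolding D_def using fin that by (intro Max_ge) auto
  show ?thesis
  proof (rule that[of D])
    fix \<chi> w assume \<chi>: "coset_ann n (gletters H) (gletters G) \<chi>" and w: "set w \<subseteq> gletters G" "D < length w"
    define \<chi>' where "\<chi>' v = (if D < length v then \<chi> v else 0)" for v
    have \<chi>': "coset_ann n (gletters H) (gletters G) \<chi>'"
      using coset_ann_restrict[OF \<chi>, of "\<lambda>k _. D < k"] by (simp add: \<chi>'_def[abs_def])
    have "pair \<chi>' s = 0" if s: "s \<in> S" for s
    proof -
      have "s \<in> FA n" using s S by (auto simp: EG_eq words_mod_FA)
      then have "pair \<chi>' s = pair \<chi>' (a s)"
        using a[OF s] coset_ann_rels[OF \<chi>'] by (intro pair_eqv) auto
      also have "\<dots> = 0" by (rule pair_eq_0) (use D[OF s] in \<open>force simp: \<chi>'_def\<close>)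
      finally show ?thesis .
    qed
    then have "\<chi>' w = 0" using generates_spanning[OF HG S(2,3) \<chi>'] w by blast
    then show "\<chi> w = 0" using w by (simp add: \<chi>'_def)
  qed
qed

lemma pair_counit_EGplus: "f \<in> EGplus n H \<Longrightarrow> pair (\<lambda>w. if w = [] then 1 else 0) f = 0"
  unfolding EGplus_eq by (erule words_mod_pair_eq_0[OF _ ann_rels_counit]) simp

text \<open>A spanning word \<open>t # w\<close> is handled by expanding \<open>w\<close> over M and
  multiplying all coefficients by the letter \<open>t\<close> on the left, which moves them into
  E_H^+.\<close>

lemma generates_expansion:
  assumes HG: "gletters H \<subseteq> letters n" "gletters G \<subseteq> letters n"
    and M: "M \<subseteq> EG n G" "generates n H G M"
    and f: "f \<in> coset_ideal n (gletters H) (gletters G)"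
  obtains F c where "finite F" "F \<subseteq> M" "\<And>m. c m \<in> EGplus n H" "\<And>m. m \<notin> F \<Longrightarrow> c m = 0"
    "f - (\<Sum>m\<in>F. fmul (c m) m) \<in> Ideal n"
proof -
  \<comment> \<open>Coefficients vanish off \<open>F\<close>, so that two expansions can be added
    over the union of their index sets.\<close>
  define P where "P f \<longleftrightarrow> (\<exists>F c. finite F \<and> F \<subseteq> M \<and> (\<forall>m. c m \<in> EGplus n H) \<and> (\<forall>m. m \<notin> F \<longrightarrow> c m = 0) \<and>
    f - (\<Sum>m\<in>F. fmul (c m) m) \<in> Ideal n)" for f
  have sub: "fa.subspace (EGplus n H)" unfolding EGplus_eq by (rule subspace_words_mod)
  have I: "P r" if "r \<in> Ideal n" for r
    unfolding P_def using that fa.subspace_0[OF sub] by (intro exI[of _ "{}"] exI[of _ "\<lambda>_. 0"]) auto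
  have "fa.subspace {f. P f}"
  proof (rule fa.subspaceI; clarsimp)
    show "P 0" using I zero_Ideal by blast
    fix x assume "P x"
    then obtain F c where F: "finite F" "F \<subseteq> M" "\<And>m. c m \<in> EGplus n H" "\<And>m. m \<notin> F \<Longrightarrow> c m = 0"
      "x - (\<Sum>m\<in>F. fmul (c m) m) \<in> Ideal n" unfolding P_def by auto
    show "P (fsmult k x)" for k
      unfolding P_def
    proof (intro exI conjI allI impI)
      show "fsmult k (c m) \<in> EGplus n H" for m using F(3) by (rule fa.subspace_scale[OF sub])
      show "fsmult k (c m) = 0" if "m \<notin> F" for m using F(4)[OF that] by simp
      show "fsmult k x - (\<Sum>m\<in>F. fmul (fsmult k (c m)) m) \<in> Ideal n"
        using fa.subspace_scale[OF subspace_Ideal F(5), of k]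
        by (simp add: fmul_fsmult_left fa.scale_right_diff_distrib fa.scale_sum_right)
    qed (use F in auto)
    fix y assume "P y"
    then obtain F' c' where F': "finite F'" "F' \<subseteq> M" "\<And>m. c' m \<in> EGplus n H" "\<And>m. m \<notin> F' \<Longrightarrow> c' m = 0"
      "y - (\<Sum>m\<in>F'. fmul (c' m) m) \<in> Ideal n" unfolding P_def by auto
    show "P (x + y)"
      unfolding P_def
    proof (intro exI conjI allI impI)
      show "finite (F \<union> F')" "F \<union> F' \<subseteq> M" using F F' by auto
      show "c m + c' m \<in> EGplus n H" for m using F(3) F'(3) by (rule fa.subspace_add[OF sub])
      show "c m + c' m = 0" if "m \<notin> F \<union> F'" for m using that F(4) F'(4) by simp
      have 1: "(\<Sum>m\<in>F \<union> F'. fmul (c m) m) = (\<Sum>m\<in>F. fmul (c m) m)"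
        using F F' by (intro sum.mono_neutral_right) auto
      have 2: "(\<Sum>m\<in>F \<union> F'. fmul (c' m) m) = (\<Sum>m\<in>F'. fmul (c' m) m)"
        using F F' by (intro sum.mono_neutral_right) auto
      have "x + y - (\<Sum>m\<in>F \<union> F'. fmul (c m + c' m) m) =
        (x - (\<Sum>m\<in>F. fmul (c m) m)) + (y - (\<Sum>m\<in>F'. fmul (c' m) m))"
        by (simp add: fmul_plus_left sum.distrib 1 2)
      then show "x + y - (\<Sum>m\<in>F \<union> F'. fmul (c m + c' m) m) \<in> Ideal n"
        using fa.subspace_add[OF subspace_Ideal F(5) F'(5)] by (simp only:)
    qed
  qed
  moreover have "P (wrd (t # w))" if t: "t \<in> gletters H" and w: "set w \<subseteq> gletters G" for t w
  proof -
    have wE: "wrd w \<in> EG n G" unfolding EG_eq using w HG by (intro words_mod_wrd) auto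
    then obtain F c where F: "finite F" "F \<subseteq> M" and c: "\<And>m. m \<in> F \<Longrightarrow> c m \<in> EG n H"
      and eq: "wrd w - lcomb F c \<in> Ideal n"
      using M(2) unfolding generates_def eqv_def fa_eqs by meson
    have tn: "wrd [t] \<in> FA n" using t HG by (auto simp: FA_def)
    show ?thesis unfolding P_def
    proof (intro exI conjI allI impI)
      show "(if m \<in> F then fmul (wrd [t]) (c m) else 0) \<in> EGplus n H" for m
      proof (cases "m \<in> F")
        case True
        have "wrd [t] \<in> words_mod n (\<lambda>w. set w \<subseteq> gletters H \<and> w \<noteq> [])"
          using t HG by (intro words_mod_wrd) auto
        then have "fmul (wrd [t]) (c m) \<in> EGplus n H"
          using c[OF True] unfolding EG_eq EGplus_eq by (rule words_mod_fmul) auto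
        then show ?thesis using True by simp
      qed (simp add: fa.subspace_0[OF sub])
      have "(\<Sum>m\<in>F. fmul (if m \<in> F then fmul (wrd [t]) (c m) else 0) m) = (\<Sum>m\<in>F. fmul (wrd [t]) (fmul (c m) m))"
      proof (rule sum.cong)
        fix m assume m: "m \<in> F"
        then have "finite (supp (c m))" "finite (supp m)"
          using c[OF m] F(2) M(1) unfolding EG_eq by (auto intro: words_mod_finite)
        then show "fmul (if m \<in> F then fmul (wrd [t]) (c m) else 0) m = fmul (wrd [t]) (fmul (c m) m)"
          using m by (simp add: fmul_assoc)
      qed simp
      also have "\<dots> = fmul (wrd [t]) (lcomb F c)" by (simp add: lcomb_eq fmul_sum_right)
      finally have "wrd (t # w) - (\<Sum>m\<in>F. fmul (if m \<in> F then fmul (wrd [t]) (c m) else 0) m)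
        = fmul (wrd [t]) (wrd w - lcomb F c)" by (simp add: fmul_minus_right fmul_wrd)
      then show "wrd (t # w) - (\<Sum>m\<in>F. fmul (if m \<in> F then fmul (wrd [t]) (c m) else 0) m) \<in> Ideal n"
        using Ideal_fmul_left[OF eq tn] by (simp only:)
    qed (use F in auto)
  qed
  ultimately have "coset_ideal n (gletters H) (gletters G) \<subseteq> {f. P f}"
    unfolding coset_ideal_def using I by (intro fa.span_minimal) blast+
  then have "P f" using f by blast
  then show ?thesis unfolding P_def using that by auto
qed

text \<open>Otherwise the combination would also have an expansion with coefficients in E_H^+.
  Freeness makes the coefficients agree at \<open>m\<close>, but the counit is 1 on one and 0 on the
  other.\<close>

lemma coset_reps_independent:
  assumes HG: "gletters H \<subseteq> letters n" "gletters G \<subseteq> letters n"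
    and M: "M \<subseteq> EG n G" "generates n H G M" "lin_indep n H M"
    and m: "m \<in> M" "m' \<in> M" "m \<noteq> m' \<or> k = 0"
  shows "m - fsmult k m' \<notin> coset_ideal n (gletters H) (gletters G)"
proof
  assume "m - fsmult k m' \<in> coset_ideal n (gletters H) (gletters G)"
  then obtain F c where F: "finite F" "F \<subseteq> M" "\<And>m. c m \<in> EGplus n H" "\<And>m. m \<notin> F \<Longrightarrow> c m = 0"
    and eq: "m - fsmult k m' - (\<Sum>m\<in>F. fmul (c m) m) \<in> Ideal n"
    by (rule generates_expansion[OF HG M(1,2)]) blast
  \<comment> \<open>These are the scalar coefficients of the combination; under the last condition
    on \<open>m\<close> the one at \<open>m\<close> is 1.\<close>
  define e where "e x = fsmult ((if x = m then 1 else 0) - (if x = m' then k else 0)) (wrd [])" for x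
  define F' where "F' = insert m (insert m' F)"
  have fin: "finite (supp m)" "finite (supp m')"
    using m M(1) unfolding EG_eq by (auto intro: words_mod_finite)
  have F': "finite F'" "F' \<subseteq> M" using F m by (auto simp: F'_def)
  have "(\<Sum>x\<in>F'. fmul (e x) x) = (\<Sum>x\<in>F'. (if x = m then fmul (wrd []) x else 0) - (if x = m' then fsmult k (fmul (wrd []) x) else 0))"
    unfolding e_def fa.scale_left_diff_distrib fmul_minus_left fmul_fsmult_left
    by (intro sum.cong) auto
  also have "\<dots> = m - fsmult k m'"
    using F'(1) fin by (simp add: sum_subtractf fmul_Nil_left) (simp add: F'_def)
  finally have e: "(\<Sum>x\<in>F'. fmul (e x) x) = m - fsmult k m'" .
  have c: "(\<Sum>x\<in>F'. fmul (c x) x) = (\<Sum>x\<in>F. fmul (c x) x)"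
    using F F' by (intro sum.mono_neutral_right) (auto simp: F'_def)
  have "lcomb F' (\<lambda>x. e x - c x) = m - fsmult k m' - (\<Sum>x\<in>F. fmul (c x) x)"
    by (simp add: lcomb_eq fmul_minus_left sum_subtractf e c)
  then have "eqv n (lcomb F' (\<lambda>x. e x - c x)) fzero" using eq by (simp add: eqv_def fa_eqs)
  moreover have "e x - c x \<in> EG n H" for x
  proof -
    have "c x \<in> EG n H" using F(3)[of x] unfolding EGplus_eq EG_eq by (rule words_mod_mono) simp
    moreover have "e x \<in> EG n H"
      unfolding e_def EG_eq by (intro fa.subspace_scale[OF subspace_words_mod] words_mod_wrd) auto
    ultimately show ?thesis unfolding EG_eq by (intro fa.subspace_diff[OF subspace_words_mod])
  qed
  moreover have "m \<in> F'" by (simp add: F'_def)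
  ultimately have "eqv n (e m - c m) fzero"
    using M(3)[unfolded lin_indep_def, rule_format, of F' "\<lambda>x. e x - c x" m] F' by blast
  then have "e m - c m \<in> Ideal n" by (simp add: eqv_def fa_eqs)
  then have "pair (\<lambda>w. if w = [] then 1 else 0) (e m - c m) = 0"
    by (rule pair_Ideal) (rule ann_rels_counit)
  moreover have "finite (supp (c m))" using F(3)[of m] unfolding EGplus_eq by (rule words_mod_finite)
  ultimately have "pair (\<lambda>w. if w = [] then 1 else 0) (e m) = 0"
    using pair_counit_EGplus[OF F(3)] by (simp add: pair_minus e_def finite_supp_fsmult)
  then show False using m(3) by (auto simp: e_def pair_fsmult)
qed

lemma gletters_letters: "simple_graph n G \<Longrightarrow> gletters G \<subseteq> letters n"
proof
  fix t assume G: "simple_graph n G" and "t \<in> gletters G"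
  then obtain i j where t: "t = (i, j)" "{i, j} \<in> G" "i \<noteq> j" by (auto simp: gletters_def)
  then obtain i' j' where "{i, j} = {i', j'}" "i' \<in> {1..n}" "j' \<in> {1..n}"
    using G unfolding simple_graph_def by metis
  then show "t \<in> letters n" using t by (auto simp: letters_iff doubleton_eq_iff)
qed

section \<open>The top representative and the three claims\<close>

theorem mainTheorem6:
  fixes n :: nat and G H :: "nat set set" and M :: "fa set"
  assumes "1 \<le> n"
    and "simple_graph n G"
    and "H \<subseteq> G"
    and "fin_gen n H G"
    and "hom_coset_reps n H G M"
  shows "\<exists>m0\<in>M. \<exists>d.
           homog n d m0
         \<and> (\<forall>m\<in>M. \<forall>e. homog n e m \<longrightarrow> e \<le> d)
         \<and> (\<forall>m\<in>M. homog n d m \<longrightarrow> m = m0)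
         \<and> (\<forall>m\<in>M. \<exists>\<psi>. gdual n \<psi>
                \<and> (\<forall>f\<in>prodspace n (EGplus n H) (FA n). pair \<psi> f = 0)
                \<and> fsub m (costar \<psi> m0) \<in> prodspace n (EGplus n H) (EG n G))
         \<and> (\<forall>m\<in>M. \<exists>g\<in>EG n G. fsub m0 (fmul m g) \<in> prodspace n (EGplus n H) (EG n G))"
proof -
  define X where "X = gletters H"
  define Y where "Y = gletters G"
  have XY: "X \<subseteq> Y" using assms(3) by (auto simp: X_def Y_def gletters_def)
  have Y: "Y \<subseteq> letters n" using gletters_letters[OF assms(2)] by (simp add: Y_def)
  have X: "X \<subseteq> letters n" using XY Y by blast
  have M: "M \<subseteq> EG n G" "generates n H G M" "lin_indep n H M"
    and hom: "\<And>m. m \<in> M \<Longrightarrow> \<exists>d. homog n d m"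
    using assms(5) by (auto simp: hom_coset_reps_def)
  have HG: "gletters H \<subseteq> letters n" "gletters G \<subseteq> letters n" "gletters H \<subseteq> gletters G"
    using X Y XY by (auto simp: X_def Y_def)
  have EGY: "EG n G = words_mod n (\<lambda>w. set w \<subseteq> Y)" by (simp add: EG_eq Y_def)
  have ME: "m \<in> words_mod n (\<lambda>w. set w \<subseteq> Y)" if "m \<in> M" for m using that M EGY by blast
  \<comment> \<open>The locale works with combinations of words over Y; an element of E_G has such a
    representative, and functionals on E_n do not distinguish the two.\<close>
  have rep: "\<exists>a\<in>word_space Y. \<forall>\<psi>. ann_rels n \<psi> \<longrightarrow> pair \<psi> x = pair \<psi> a"
    if x: "x \<in> words_mod n (\<lambda>w. set w \<subseteq> Y)" for x
  proof -
    obtain a where a: "a \<in> FA n" "x - a \<in> Ideal n" "\<And>w. w \<in> supp a \<Longrightarrow> set w \<subseteq> Y"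
      using x by (rule words_modE) blast
    then have "a \<in> word_space Y" by (simp add: word_space_def FA_def)
    then show ?thesis using pair_eqv[OF words_mod_FA[OF x] a(1,2)] by blast
  qed
  obtain D where D: "\<And>\<chi> w. coset_ann n X Y \<chi> \<Longrightarrow> set w \<subseteq> Y \<Longrightarrow> D < length w \<Longrightarrow> \<chi> w = 0"
    unfolding X_def Y_def by (rule generates_bounded[OF HG(3,2) assms(4)]) blast
  \<comment> \<open>\<open>Q k\<close> expresses that A is nonzero in degree \<open>k\<close>. It
    holds at 0 by the counit and fails above \<open>D\<close>, so there is a largest degree
    \<open>d\<close>.\<close>
  define Q where "Q k \<longleftrightarrow> (\<exists>\<chi> w. coset_ann n X Y \<chi> \<and> set w \<subseteq> Y \<and> length w = k \<and> \<chi> w \<noteq> 0)" for k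
  have "Q 0"
    unfolding Q_def using coset_ann_counit[of n X Y] by (intro exI[of _ "\<lambda>w. if w = [] then 1 else 0"] exI[of _ "[]"]) simp
  moreover have QD: "k \<le> D" if "Q k" for k using that D unfolding Q_def by (metis not_le)
  ultimately have "\<exists>d. Q d \<and> (\<forall>k. Q k \<longrightarrow> k \<le> d)"
    using GreatestI_nat[of Q 0 D] Greatest_le_nat[of Q _ D] by blast
  then obtain d where d: "Q d" "\<And>k. Q k \<Longrightarrow> k \<le> d" by blast
  obtain \<phi>0 w0 where \<phi>0: "coset_ann n X Y \<phi>0" and w0: "set w0 \<subseteq> Y" "length w0 = d" "\<phi>0 w0 \<noteq> 0"
    using d(1) unfolding Q_def by blast
  \<comment> \<open>Projecting to degree \<open>d\<close> and to the S_n-degree of \<open>w0\<close>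
    preserves \<open>coset_ann\<close> and the value at \<open>w0\<close>.\<close>
  define \<phi> where "\<phi> w = (if length w = d \<and> sigma_w w = sigma_w w0 then \<phi>0 w else 0)" for w
  have \<phi>: "coset_ann n X Y \<phi>"
    using coset_ann_restrict[OF \<phi>0, of "\<lambda>k \<sigma>. k = d \<and> \<sigma> = sigma_w w0"] by (simp add: \<phi>_def[abs_def])
  note \<phi>r = coset_ann_rels[OF \<phi>]
  interpret top: coset_top n X Y d \<phi> w0
  proof
    show "coset_ann n X Y \<phi>" by (rule \<phi>)
    show "length w = d \<and> sigma_w w = sigma_w w0" if "\<phi> w \<noteq> 0" for w
      using that by (auto simp: \<phi>_def split: if_splits)
    show "\<phi> w0 \<noteq> 0" using w0 by (simp add: \<phi>_def)
    show "\<chi> w = 0" if "coset_ann n X Y \<chi>" "set w \<subseteq> Y" "d < length w" for \<chi> w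
      using d(2)[of "length w"] that unfolding Q_def by (metis not_le)
  qed (use XY Y w0 in auto)
  have \<phi>len: "\<phi> w = 0" if "length w \<noteq> d" for w using that by (simp add: \<phi>_def)
  have comb: "x - fsmult k y \<in> words_mod n P" if "x \<in> words_mod n P" "y \<in> words_mod n P" for x y k P
    using that by (intro fa.subspace_diff[OF subspace_words_mod] fa.subspace_scale[OF subspace_words_mod])
  \<comment> \<open>The factor \<open>k\<close> covers two facts at once: representatives are
    nonzero in A (\<open>k = 0\<close>), and distinct ones are not proportional.\<close>
  have not_ann: "\<exists>\<chi>. coset_ann n X Y \<chi> \<and> pair \<chi> (m - fsmult k m') \<noteq> 0"
    if m: "m \<in> M" "m' \<in> M" "m \<noteq> m' \<or> k = 0" for m m' k
  proof (rule ccontr)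
    assume *: "\<nexists>\<chi>. coset_ann n X Y \<chi> \<and> pair \<chi> (m - fsmult k m') \<noteq> 0"
    have "m - fsmult k m' \<in> FA n"
      using comb[OF ME[OF m(1)] ME[OF m(2)]] by (rule words_mod_FA)
    then have "m - fsmult k m' \<in> coset_ideal n X Y"
      using * by (intro coset_ideal_if_annihilated[OF X Y]) auto
    then show False using coset_reps_independent[OF HG(1,2) M m] by (simp add: X_def Y_def)
  qed
  have not_ann1: "\<exists>\<chi>. coset_ann n X Y \<chi> \<and> pair \<chi> m \<noteq> 0" if "m \<in> M" for m
    using not_ann[OF that that, of 0] by simp
  \<comment> \<open>A_d is a line: for \<open>x\<close> of degree \<open>d\<close> and nonempty
    \<open>g\<close> the value \<phi>(x g) is zero by degree, so \<phi>(x) = 0 puts \<open>x\<close>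
    in the radical.\<close>
  have top_ann: "pair \<chi> x = 0"
    if x: "x \<in> words_mod n (\<lambda>w. set w \<subseteq> Y)" "x \<in> words_mod n (\<lambda>w. length w = d)"
      and 0: "pair \<phi> x = 0" and \<chi>: "coset_ann n X Y \<chi>" for x \<chi>
  proof -
    obtain a where a: "a \<in> word_space Y" "\<And>\<psi>. ann_rels n \<psi> \<Longrightarrow> pair \<psi> x = pair \<psi> a"
      using rep[OF x(1)] by blast
    have "pair \<chi> a = 0"
    proof (rule top.radical_eq_0[OF a(1) _ \<chi>])
      fix g assume g: "set g \<subseteq> Y"
      have r: "ann_rels n (\<lambda>w. \<phi> (w @ g))"
        using ann_rels_shift[OF \<phi>r, of "[]" g] g Y by auto
      have "pair (\<lambda>w. \<phi> (w @ g)) x = 0"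
      proof (cases g)
        case Nil then show ?thesis using 0 by simp
      next
        case Cons
        then show ?thesis by (intro words_mod_pair_eq_0[OF x(2) r] \<phi>len) simp
      qed
      then show "pair (\<lambda>w. \<phi> (w @ g)) a = 0" using a(2)[OF r] by simp
    qed
    then show ?thesis using a(2)[OF coset_ann_rels[OF \<chi>]] by simp
  qed
  \<comment> \<open>A functional that is nonzero on \<open>m\<close> can be cut down to length
    \<open>e\<close>; it is then nonzero on a word of that length, so \<open>Q e\<close>
    holds.\<close>
  have deg: "e \<le> d" if m: "m \<in> M" and e: "homog n e m" for m e
  proof -
    obtain \<chi> where \<chi>: "coset_ann n X Y \<chi>" "pair \<chi> m \<noteq> 0" using not_ann1[OF m] by blast
    define \<chi>' where "\<chi>' w = (if length w = e then \<chi> w else 0)" for w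
    have \<chi>': "coset_ann n X Y \<chi>'"
      using coset_ann_restrict[OF \<chi>(1), of "\<lambda>k _. k = e"] by (simp add: \<chi>'_def[abs_def])
    have "pair \<chi>' m = pair \<chi> m"
      using e unfolding homog_iff
      by (rule words_mod_pair_cong[OF _ coset_ann_rels[OF \<chi>'] coset_ann_rels[OF \<chi>(1)]]) (simp add: \<chi>'_def)
    then have "\<exists>w. set w \<subseteq> Y \<and> \<chi>' w \<noteq> 0"
      using words_mod_pair_eq_0[OF ME[OF m] coset_ann_rels[OF \<chi>']] \<chi>(2) by metis
    then obtain w where w: "set w \<subseteq> Y" "\<chi>' w \<noteq> 0" by blast
    then have "length w = e" "\<chi> w \<noteq> 0" by (auto simp: \<chi>'_def split: if_splits)
    then show "e \<le> d" using d(2)[of e] \<chi>(1) w(1) unfolding Q_def by blast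
  qed
  \<comment> \<open>M spans A, so a functional killing all of M would also kill
    \<open>w0\<close>.\<close>
  have "\<exists>m0\<in>M. pair \<phi> m0 \<noteq> 0"
  proof (rule ccontr)
    assume "\<not> (\<exists>m0\<in>M. pair \<phi> m0 \<noteq> 0)"
    then have "\<phi> w0 = 0"
      using generates_spanning[OF HG(3,2) M(1,2) \<phi>[unfolded X_def Y_def]] w0(1) by (auto simp: Y_def)
    then show False using w0 by (simp add: \<phi>_def)
  qed
  then obtain m0 where m0: "m0 \<in> M" "pair \<phi> m0 \<noteq> 0" by blast
  have m0d: "homog n d m0"
  proof -
    obtain e where e: "homog n e m0" using hom[OF m0(1)] by blast
    have "e = d"
    proof (rule ccontr)
      assume "e \<noteq> d"
      then have "pair \<phi> m0 = 0"
        by (intro words_mod_pair_eq_0[OF e[unfolded homog_iff] \<phi>r] \<phi>len) auto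
      then show False using m0 by simp
    qed
    then show ?thesis using e by simp
  qed
  have m0fin: "finite (supp m0)" using ME[OF m0(1)] by (rule words_mod_finite)
  have pair_comb: "pair \<chi> (x - fsmult k y) = pair \<chi> x - k * pair \<chi> y"
    if "finite (supp x)" "finite (supp y)" for \<chi> x y k
    using that by (simp add: pair_minus pair_fsmult finite_supp_fsmult)
  have uniq: "m = m0" if m: "m \<in> M" "homog n d m" for m
  proof (rule ccontr)
    assume "m \<noteq> m0"
    define k where "k = pair \<phi> m / pair \<phi> m0"
    have "pair \<phi> (m - fsmult k m0) = 0"
      using m0 m0fin words_mod_finite[OF ME[OF m(1)]] by (simp add: pair_comb k_def)
    then have "pair \<chi> (m - fsmult k m0) = 0" if "coset_ann n X Y \<chi>" for \<chi>
      using top_ann[OF comb[OF ME[OF m(1)] ME[OF m0(1)]] comb[OF m(2)[unfolded homog_iff] m0d[unfolded homog_iff]]] that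
      by blast
    then show False using not_ann[OF m(1) m0(1)] \<open>m \<noteq> m0\<close> by blast
  qed
  have b: "\<exists>\<psi>. gdual n \<psi> \<and> (\<forall>f\<in>prodspace n (EGplus n H) (FA n). pair \<psi> f = 0)
      \<and> fsub m (costar \<psi> m0) \<in> prodspace n (EGplus n H) (EG n G)" if m: "m \<in> M" for m
  proof -
    \<comment> \<open>As A_d is a line, \<open>m0\<close> is a multiple of \<open>w0\<close> in A;
      comparing values of \<phi> gives the factor.\<close>
    define k where "k = pair \<phi> m0 / \<phi> w0"
    have \<phi>w0: "\<phi> w0 \<noteq> 0" using w0 by (simp add: \<phi>_def)
    have k: "k \<noteq> 0" using m0 \<phi>w0 by (simp add: k_def)
    have "wrd w0 \<in> words_mod n (\<lambda>w. set w \<subseteq> Y)" "wrd w0 \<in> words_mod n (\<lambda>w. length w = d)"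
      using w0 Y by (auto intro!: words_mod_wrd)
    note w0_comb = comb[OF ME[OF m0(1)] this(1)] comb[OF m0d[unfolded homog_iff] this(2)]
    have "pair \<phi> (m0 - fsmult k (wrd w0)) = 0"
      using \<phi>w0 m0fin by (simp add: pair_comb k_def)
    then have "pair \<chi> (m0 - fsmult k (wrd w0)) = 0" if "coset_ann n X Y \<chi>" for \<chi>
      using top_ann[OF w0_comb] that by blast
    then have pm0: "pair \<chi> m0 = k * \<chi> w0" if "coset_ann n X Y \<chi>" for \<chi>
      using that m0fin by (simp add: pair_comb)
    obtain a where a: "a \<in> word_space Y" "\<And>\<psi>. ann_rels n \<psi> \<Longrightarrow> pair \<psi> m = pair \<psi> a"
      using rep[OF ME[OF m]] by blast
    obtain q where q: "coset_ann n X (letters n) q" "\<And>\<chi>. coset_ann n X Y \<chi> \<Longrightarrow> pair \<chi> a = star q \<chi> w0"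
      by (rule top.orbit_spanning[OF a(1)]) blast
    \<comment> \<open>Dividing by \<open>k\<close> passes from \<open>w0\<close> to
      \<open>m0\<close>. The cut at length \<open>d\<close> puts \<psi> in the graded dual and
      leaves its convolutions unchanged at \<open>w0\<close>, whose left factors have at most
      \<open>d\<close> letters.\<close>
    define \<psi> where "\<psi> w = (if length w \<le> d then 1 / k * q w else 0)" for w
    have \<psi>: "coset_ann n X (letters n) \<psi>"
      using coset_ann_restrict[OF coset_ann_scale[OF q(1), of "1 / k"], of "\<lambda>l _. l \<le> d"] by (simp add: \<psi>_def[abs_def])
    have star: "star \<psi> \<chi> w0 = 1 / k * star q \<chi> w0" for \<chi>
      unfolding star_def copsum_mult_left[symmetric]
    proof (rule copsum_cong)
      fix L R assume "(L, R) \<in> set (cops w0)"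
      then have "length L \<le> d" using cops_length w0(2) by fastforce
      then show "\<psi> L * \<chi> R = 1 / k * (q L * \<chi> R)" by (simp add: \<psi>_def)
    qed
    have "gdual n \<psi>"
      unfolding gdual_def
    proof
      show "\<exists>D. \<forall>w. D < length w \<longrightarrow> \<psi> w = 0" by (rule exI[of _ d]) (simp add: \<psi>_def)
      show "\<forall>r\<in>Ideal n. pair \<psi> r = 0" using pair_Ideal coset_ann_rels[OF \<psi>] by blast
    qed
    moreover have "\<forall>f\<in>prodspace n (EGplus n H) (FA n). pair \<psi> f = 0"
      using pair_prodspace \<psi> by (simp add: X_def)
    moreover have "m - costar \<psi> m0 \<in> prodspace n (EGplus n H) (EG n G)"
    proof (rule prodspaceI[OF HG(1,2)])
      show "m - costar \<psi> m0 \<in> FA n"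
        using words_mod_FA[OF ME[OF m]] pair_costar(3)[OF m0fin words_mod_FA[OF ME[OF m0(1)]]]
        by (rule fa.subspace_diff[OF subspace_FA])
      fix \<chi> assume "coset_ann n (gletters H) (gletters G) \<chi>"
      then have \<chi>: "coset_ann n X Y \<chi>" by (simp add: X_def Y_def)
      have "pair \<chi> (m - costar \<psi> m0) = pair \<chi> m - pair (star \<psi> \<chi>) m0"
        using pair_costar(1,2)[OF m0fin] words_mod_finite[OF ME[OF m]] by (simp add: pair_minus)
      also have "pair \<chi> m = star q \<chi> w0" using a(2)[OF coset_ann_rels[OF \<chi>]] q(2)[OF \<chi>] by simp
      \<comment> \<open>The convolution \<open>star \<psi> \<chi>\<close> is again a coset
        functional, so \<open>pm0\<close> applies to it.\<close>
      also have "pair (star \<psi> \<chi>) m0 = star q \<chi> w0"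
        using pm0[OF coset_ann_star[OF \<psi> \<chi> Y]] k by (simp add: star)
      finally show "pair \<chi> (m - costar \<psi> m0) = 0" by simp
    qed
    ultimately show ?thesis by (auto simp: fa_eqs)
  qed
  have c: "\<exists>g\<in>EG n G. fsub m0 (fmul m g) \<in> prodspace n (EGplus n H) (EG n G)" if m: "m \<in> M" for m
  proof -
    obtain a where a: "a \<in> word_space Y" "\<And>\<psi>. ann_rels n \<psi> \<Longrightarrow> pair \<psi> m = pair \<psi> a"
      using rep[OF ME[OF m]] by blast
    obtain e where e: "m \<in> words_mod n (\<lambda>w. length w = e)" using hom[OF m] by (auto simp: homog_iff)
    obtain \<chi> where \<chi>: "coset_ann n X Y \<chi>" "pair \<chi> m \<noteq> 0" using not_ann1[OF m] by blast
    then have "pair \<chi> a \<noteq> 0" using a(2)[OF coset_ann_rels[OF \<chi>(1)]] by simp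
    \<comment> \<open>Being nonzero in A, \<open>m\<close> lies outside the radical of the
      form.\<close>
    then obtain g where g: "set g \<subseteq> Y" "pair (\<lambda>w. \<phi> (w @ g)) a \<noteq> 0"
      using top.radical_eq_0[OF a(1) _ \<chi>(1)] by blast
    have r: "ann_rels n (\<lambda>w. \<phi> (w @ g))" using ann_rels_shift[OF \<phi>r, of "[]" g] g Y by auto
    have mg: "pair (\<lambda>w. \<phi> (w @ g)) m \<noteq> 0" using g(2) a(2)[OF r] by simp
    have len: "e + length g = d"
    proof (rule ccontr)
      assume "e + length g \<noteq> d"
      then have "pair (\<lambda>w. \<phi> (w @ g)) m = 0"
        by (intro words_mod_pair_eq_0[OF e r] \<phi>len) simp
      then show False using mg by simp
    qed
    have fin: "finite (supp m)" using ME[OF m] by (rule words_mod_finite)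
    have gY: "wrd g \<in> words_mod n (\<lambda>w. set w \<subseteq> Y)" "wrd g \<in> words_mod n (\<lambda>w. length w = length g)"
      using g Y by (auto intro!: words_mod_wrd)
    have mgY: "fmul m (wrd g) \<in> words_mod n (\<lambda>w. set w \<subseteq> Y)"
      using ME[OF m] gY(1) by (rule words_mod_fmul) simp
    have mgd: "fmul m (wrd g) \<in> words_mod n (\<lambda>w. length w = d)"
      using e gY(2) by (rule words_mod_fmul) (use len in simp)
    \<comment> \<open>The product of \<open>m\<close> and \<open>g\<close> and the element
      \<open>m0\<close> both lie on the line A_d; \<open>k\<close> is the ratio of their values
      under \<phi>.\<close>
    define k where "k = pair \<phi> m0 / pair \<phi> (fmul m (wrd g))"
    have nz: "pair \<phi> (fmul m (wrd g)) \<noteq> 0" using mg fin by (simp add: pair_fmul)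
    have "pair \<phi> (m0 - fsmult k (fmul m (wrd g))) = 0"
      using nz m0fin words_mod_finite[OF mgY] by (simp add: pair_comb k_def)
    then have "pair \<chi> (m0 - fsmult k (fmul m (wrd g))) = 0" if "coset_ann n X Y \<chi>" for \<chi>
      using top_ann[OF comb[OF ME[OF m0(1)] mgY] comb[OF m0d[unfolded homog_iff] mgd]] that by blast
    then have "m0 - fmul m (fsmult k (wrd g)) \<in> prodspace n (EGplus n H) (EG n G)"
      unfolding fmul_fsmult_right
      using words_mod_FA[OF comb[OF ME[OF m0(1)] mgY]]
      by (intro prodspaceI[OF HG(1,2)]) (auto simp: X_def Y_def)
    moreover have "fsmult k (wrd g) \<in> EG n G"
      unfolding EGY using gY(1) by (rule fa.subspace_scale[OF subspace_words_mod])
    ultimately show ?thesis by (auto simp: fa_eqs)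
  qed
  show ?thesis using m0(1) m0d deg uniq b c by blast
qed

end
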